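(* Let $X$ be a locally compact $\sigma$-compact non-discrete group, let $\mu$ be a left-invariant Haar measure in $X$, and let $m>0$. Then $$\mathrm{M}(X,\mu)\cap \mathrm{H}_m(X,\mu)\subset \mathrm{A}_m(X,\mu).$$
   Context: Notation. $\log$ denotes $\log_2$, and $\log^{+}u=\max\{\log u,0\}$ for $u>0$, $\log^+0=0$. $L^0(X,\mu)$ is the class of all measurable functions $f:X\to[-\infty,\infty]$, and $L(X,\mu)$ is the class of all integrable ones. $\chi_E$ is the characteristic function of $E\subset X$. $\Phi$ is the set of all increasing continuous functions $\varphi:[0,\infty)\to[0,\infty)$ with $\varphi(0)=0$ and $\liminf_{u\to\infty}\varphi(u)/u>0$. An operator $T:L(X,\mu)\to L^0(X,\mu)$ is sub-linear if $|T(f+g)|\le |Tf|+|Tg|$ and $|T(cf)|=|c||Tf|$ a.e. for all $f,g\in L(X,\mu)$ and scalars $c$. Restricted weak type. For $1\le p<\infty$, an operator $T:L(X,\mu)\to L^0(X,\mu)$ is of restricted weak type $p$ with constant $C_p>0$ if $\mu(\{|T\chi_E|>\lambda\})\le C_p\lambda^{-p}\mu(E)$ for every measurable $E\subset X$ with finite measure and every $\lambda>0$. Generalized weak type. For $\varphi\in\Phi$, an operator $T:L(X,\mu)\to L^0(X,\mu)$ is of generalized weak type $\varphi$ if for every measurable $Y\subset X$ with finite measure and every $\varepsilon>0$ there is a number $C_{Y,\varepsilon}>0$ such that $\mu(\{|Tf|>\lambda\}\cap Y)\le \varepsilon+C_{Y,\varepsilon}\int_X\varphi(|f|/\lambda)\,d\mu$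 for every $f\in L(X,\mu)$ and every $\lambda>0$. Classes of operators. - $\mathrm{H}_m(X,\mu)$ is the class of all sub-linear operators $T:L(X,\mu)\to L^0(X,\mu)$ for which there are $r=r(T)>1$ and $C=C(T)>0$ such that for every $p\in(1,r)$, $T$ is of restricted weak type $p$ with a constant $C_p$ satisfying $C_p\le\left(\frac{C}{p-1}\right)^{mp}$. - $\mathrm{A}_m(X,\mu)$ is the class of all sub-linear operators $T:L(X,\mu)\to L^0(X,\mu)$ which are of generalized weak type $\varphi$, where $\varphi(u)=u(1+\log^{+}u)^m(1+\log^{+}\log^{+}\log^{+}u)$. - For $k\in L(X,\mu)$, the convolution operator generated by $k$ is $T_kf=f*k$ $(f\in L(X,\mu))$, where $(f*k)(x)=\int_X f(y)k(y^{-1}x)\,d\mu(y)$. $\mathrm{M}(X,\mu)$ is the class of all maximal operators $M_{\mathbf T}$, $M_{\mathbf T}f(x)=\sup_{j}|T_{k_j}f(x)|$ $(f\in L(X,\mu),\ x\in X)$, where $\mathbf T=(T_{k_j})_{j\in\mathbb N}$ is a sequence of convolution operators generated by some functions $k_j\in L(X,\mu)$. *)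

theory Defs
  imports "HOL-Analysis.Analysis"
begin

(* Groups are written additively, since group_add is the library's class of (not necessarily
   commutative) groups that carries topological structure; no commutativity is assumed anywhere.
   The product xy reads x + y, and the quotient y^(-1) x reads - y + x, in this order. *)

definition sigma_compact :: "'a::topological_space set \<Rightarrow> bool" where
  "sigma_compact S \<longleftrightarrow> (\<exists>K :: nat \<Rightarrow> 'a set. (\<forall>n. compact (K n)) \<and> (\<Union>n. K n) = S)"

(* A nonzero Radon measure on the Borel sets that is invariant under left translations. The
   regularity conditions are not automatic, because the group need not be second countable. *)
definition left_haar_measure :: "'a::{topological_group_add, t2_space} measure \<Rightarrow> bool" where
  "left_haar_measure M \<longleftrightarrow>
     sets M = sets borel \<and>
     emeasure M UNIV \<noteq> 0 \<and>
     (\<forall>K. compact K \<longrightarrow> emeasure M K < \<infinity>) \<and>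
     (\<forall>A\<in>sets M. emeasure M A = (INF U\<in>{U. open U \<and> A \<subseteq> U}. emeasure M U)) \<and>
     (\<forall>U. open U \<longrightarrow> emeasure M U = (SUP K\<in>{K. compact K \<and> K \<subseteq> U}. emeasure M K)) \<and>
     (\<forall>x. \<forall>A\<in>sets M. emeasure M ((\<lambda>y. x + y) ` A) = emeasure M A)"

abbreviation L0 :: "'a measure \<Rightarrow> ('a \<Rightarrow> ereal) set" where
  "L0 M \<equiv> borel_measurable M"

definition L1 :: "'a measure \<Rightarrow> ('a \<Rightarrow> ereal) set" where
  "L1 M = {f \<in> L0 M. (\<integral>\<^sup>+x. e2ennreal \<bar>f x\<bar> \<partial>M) < \<infinity>}"

(* An operator from L1 M to L0 M is a total function on functions, of which only the restriction
   to L1 M is relevant. *)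
type_synonym 'a operator = "('a \<Rightarrow> ereal) \<Rightarrow> 'a \<Rightarrow> ereal"

(* Elements of L1 M are finite almost everywhere, so the library's value of \<infinity> + (-\<infinity>)
   enters f x + g x on a null set only. *)
definition sublinear_operator :: "'a measure \<Rightarrow> 'a operator \<Rightarrow> bool" where
  "sublinear_operator M T \<longleftrightarrow>
     (\<forall>f\<in>L1 M. T f \<in> L0 M) \<and>
     (\<forall>f\<in>L1 M. \<forall>g\<in>L1 M. AE x in M. \<bar>T (\<lambda>y. f y + g y) x\<bar> \<le> \<bar>T f x\<bar> + \<bar>T g x\<bar>) \<and>
     (\<forall>f\<in>L1 M. \<forall>c::real. AE x in M. \<bar>T (\<lambda>y. ereal c * f y) x\<bar> = ereal \<bar>c\<bar> * \<bar>T f x\<bar>)"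

definition restricted_weak_type :: "'a measure \<Rightarrow> 'a operator \<Rightarrow> real \<Rightarrow> real \<Rightarrow> bool" where
  "restricted_weak_type M T p C \<longleftrightarrow>
     1 \<le> p \<and> 0 < C \<and>
     (\<forall>E\<in>sets M. emeasure M E < \<infinity> \<longrightarrow>
        (\<forall>t::real. 0 < t \<longrightarrow>
           emeasure M {x \<in> space M. ereal t < \<bar>T (indicator E) x\<bar>}
             \<le> ennreal (C * t powr (- p)) * emeasure M E))"

definition logp :: "real \<Rightarrow> real" where
  "logp u = (if 0 < u then max (log 2 u) 0 else 0)"

(* Only the values on {0..} matter for members of Phi. *)
definition Phi :: "(real \<Rightarrow> real) set" where
  "Phi = {\<phi>. \<phi> ` {0..} \<subseteq> {0..} \<and> mono_on {0..} \<phi> \<and> continuous_on {0..} \<phi> \<and> \<phi> 0 = 0 \<and>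
              0 < Liminf at_top (\<lambda>u. ereal (\<phi> u / u))}"

(* real_of_ereal sends \<infinity> to 0, which affects the integrand on a null set only. *)
definition generalized_weak_type :: "'a measure \<Rightarrow> 'a operator \<Rightarrow> (real \<Rightarrow> real) \<Rightarrow> bool" where
  "generalized_weak_type M T \<phi> \<longleftrightarrow>
     \<phi> \<in> Phi \<and>
     (\<forall>Y\<in>sets M. emeasure M Y < \<infinity> \<longrightarrow>
        (\<forall>\<epsilon>::real. 0 < \<epsilon> \<longrightarrow>
           (\<exists>C::real. 0 < C \<and>
              (\<forall>f\<in>L1 M. \<forall>t::real. 0 < t \<longrightarrow>
                 emeasure M ({x \<in> space M. ereal t < \<bar>T f x\<bar>} \<inter> Y)
                   \<le> ennreal \<epsilon> + ennreal C *
                       (\<integral>\<^sup>+x. ennreal (\<phi> (real_of_ereal \<bar>f x\<bar> / t)) \<partial>M)))))"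

definition H_class :: "real \<Rightarrow> 'a measure \<Rightarrow> 'a operator set" where
  "H_class m M =
     {T. sublinear_operator M T \<and>
         (\<exists>r>1. \<exists>C>0. \<forall>p. 1 < p \<and> p < r \<longrightarrow>
            (\<exists>Cp. Cp \<le> (C / (p - 1)) powr (m * p) \<and> restricted_weak_type M T p Cp))}"

definition A_class :: "real \<Rightarrow> 'a measure \<Rightarrow> 'a operator set" where
  "A_class m M =
     {T. sublinear_operator M T \<and>
         generalized_weak_type M T
           (\<lambda>u. u * (1 + logp u) powr m * (1 + logp (logp (logp u))))}"

(* For f and k in L1 M the integrand is a product of almost everywhere finite functions, and it is
   integrable for almost every x; on the remaining null set of x the Bochner integral is 0. *)
definition convolution ::
    "'a::group_add measure \<Rightarrow> ('a \<Rightarrow> ereal) \<Rightarrow> ('a \<Rightarrow> ereal) \<Rightarrow> 'a \<Rightarrow> real" where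
  "convolution M f k x = (\<integral>y. real_of_ereal (f y * k (- y + x)) \<partial>M)"

definition maximal_operator :: "'a::group_add measure \<Rightarrow> (nat \<Rightarrow> 'a \<Rightarrow> ereal) \<Rightarrow> 'a operator" where
  "maximal_operator M k f x = (SUP j. ereal \<bar>convolution M f (k j) x\<bar>)"

definition maximal_operators :: "'a::group_add measure \<Rightarrow> 'a operator set" where
  "maximal_operators M = {maximal_operator M k | k. \<forall>j. k j \<in> L1 M}"

end

theory Submission
  imports Defs
begin

text \<open>For \<open>0 \<le> f \<le> A\<close> with compact support, finitely many convolutions and a compact set of
  points, Antonov's lemma gives a set \<open>E\<close> with \<open>\<mu>(E) \<le> \<integral>f / A\<close> such that \<open>f / A\<close> and the
  characteristic function of \<open>E\<close> have almost the same convolutions: the kernels are approximated by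
  continuous ones, whose translates form an equicontinuous family, and \<open>\<mu>\<close> has no atoms. Hence
  restricted weak type \<open>p\<close> yields \<open>\<mu>{Tf > t} \<le> C\<^sub>p (A / t)\<^sup>p \<integral>f / A\<close>.

  By homogeneity let \<open>t = 1\<close>, and split \<open>f\<close> into the parts \<open>f\<^sub>k\<close> where \<open>|f|\<close> lies between
  \<open>2 ^ 2 ^ k\<close> and \<open>2 ^ 2 ^ (k + 1)\<close>. With \<open>p - 1\<close> of order \<open>2\<^sup>-\<^sup>k\<close> the \<open>k\<close>-th part satisfies
  \<open>\<mu>{Tf\<^sub>k > t} \<le> C 2 ^ (m k) \<integral>|f\<^sub>k| / t\<close> for \<open>t\<close> not smaller than about \<open>k\<^sup>-\<^sup>2\<close>. The values of \<open>Tf\<^sub>k\<close> below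
  \<open>k\<^sup>-\<^sup>2\<close> add up to at most 1/2, and Chebyshev's inequality for the sum of the remaining truncations
  costs a factor \<open>log k\<close>, the number of dyadic levels between \<open>k\<^sup>-\<^sup>2\<close> and 1. This factor is the triple
  logarithm of \<open>|f|\<close>. The constant depends neither on \<open>Y\<close> nor on \<open>\<epsilon>\<close>.\<close>

section \<open>The function \<open>\<phi>\<close> and the decomposition into dyadic levels\<close>

text \<open>The powers of logarithms come from the choice of the scale. Where \<open>|f|\<close> is
  about \<open>A\<close>, restricted weak type costs a power \<open>(1 / (p - 1)) ^ m\<close> from
  the constant and \<open>A ^ (p - 1)\<close> from the height; \<open>p - 1\<close> of order
  \<open>1 / log A\<close> balances the two and leaves \<open>(log A) ^ m\<close>. One exponent
  serves all heights between \<open>A\<close> and its square, hence the cuts at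
  \<open>2 ^ 2 ^ k\<close>. Weak L1 is not normable, so adding the parts loses a factor of order
  \<open>log k\<close>, and with these cuts \<open>k\<close> is about \<open>log log |f|\<close>;
  cuts at \<open>2 ^ k\<close> would lead to a double logarithm instead. In the measure theory the
  obstacle is that the group may be neither unimodular nor second countable. Inversion is controlled
  on compact sets, which makes the convolution integrals of bounded compactly supported functions
  converge at every point. The product \<open>f y * k (- y + x)\<close> with a Borel function
  \<open>k\<close> may fail to be measurable for the product sigma-algebra, so statements that rest
  on Fubini's theorem are proved for continuous kernels and carried over by limits in L1.\<close>

lemma logp_eq: "logp u = log 2 (max u 1)"
  by (auto simp: logp_def max_def)

lemma logp_nonneg: "0 \<le> logp u"
  by (simp add: logp_eq)

lemma logp_mono: "u \<le> v \<Longrightarrow> logp u \<le> logp v"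
  by (simp add: logp_eq)

lemma logp_ge: "0 < u \<Longrightarrow> log 2 u \<le> logp u"
  by (simp add: logp_def)

lemma continuous_on_logp: "continuous_on S logp"
proof -
  have "continuous_on S (\<lambda>u. log 2 (max u 1))"
    by (intro continuous_intros) auto
  then show ?thesis
    by (simp add: logp_eq[abs_def])
qed

definition antonov_phi :: "real \<Rightarrow> real \<Rightarrow> real" where
  "antonov_phi m u = u * (1 + logp u) powr m * (1 + logp (logp (logp u)))"

lemma one_le_factors:
  assumes "0 < m"
  shows "1 \<le> (1 + logp u) powr m" "1 \<le> 1 + logp (logp (logp u))"
  using assms logp_nonneg by (auto intro!: ge_one_powr_ge_zero)

lemma antonov_phi_ge:
  assumes "0 < m" "0 \<le> u"
  shows "u \<le> antonov_phi m u"
proof -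
  have "u * 1 * 1 \<le> antonov_phi m u"
    unfolding antonov_phi_def using assms one_le_factors[OF assms(1), of u] by (intro mult_mono) auto
  then show ?thesis by simp
qed

lemma antonov_phi_in_Phi:
  assumes m: "0 < m"
  shows "antonov_phi m \<in> Phi"
proof -
  have mono: "mono_on {0..} (antonov_phi m)"
  proof (rule mono_onI)
    fix u v :: real assume uv: "u \<in> {0..}" "v \<in> {0..}" "u \<le> v"
    have 1: "u * (1 + logp u) powr m \<le> v * (1 + logp v) powr m"
      using uv m logp_nonneg[of u] logp_mono[OF uv(3)] by (intro mult_mono powr_mono2) auto
    have 2: "1 + logp (logp (logp u)) \<le> 1 + logp (logp (logp v))"
      using uv by (intro add_left_mono logp_mono)
    show "antonov_phi m u \<le> antonov_phi m v"
      unfolding antonov_phi_def using uv logp_nonneg[of "logp (logp u)"]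
      by (intro mult_mono[OF 1 2]) auto
  qed
  have "continuous_on {0..} (antonov_phi m)"
  proof -
    have n: "1 + logp u \<noteq> 0" for u
      using logp_nonneg[of u] by linarith
    have "continuous_on {0..} (\<lambda>u. logp (logp (logp u)))"
      by (intro continuous_on_compose2[OF continuous_on_logp[of UNIV]] continuous_on_logp) auto
    then show ?thesis
      unfolding antonov_phi_def by (intro continuous_intros continuous_on_logp) (auto simp: n)
  qed
  moreover have "(0::ereal) < Liminf at_top (\<lambda>u. ereal (antonov_phi m u / u))"
  proof (rule less_le_trans)
    show "(0::ereal) < 1" by simp
    show "1 \<le> Liminf at_top (\<lambda>u. ereal (antonov_phi m u / u))"
    proof (rule Liminf_bounded)
      show "eventually (\<lambda>u. 1 \<le> ereal (antonov_phi m u / u)) at_top"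
        using eventually_gt_at_top[of 0]
      proof eventually_elim
        case (elim u)
        then show ?case
          using antonov_phi_ge[OF m, of u] by (simp add: one_ereal_def)
      qed
    qed
  qed
  moreover have "antonov_phi m ` {0..} \<subseteq> {0..}"
    using antonov_phi_ge[OF m] by (force intro: order_trans)
  ultimately show ?thesis
    unfolding Phi_def using mono by (auto simp: antonov_phi_def)
qed

text \<open>The number of dyadic levels kept for the \<open>k\<close>-th piece, under two opposite
  demands. The tails \<open>(1/2) ^ levels k\<close> must have sum at most 1/2; the factor 2 and the
  summand 2 achieve this through \<open>1 / (4 * (real k + 1)\<^sup>2)\<close>. And the number may
  grow only like \<open>log k\<close>, because it becomes a factor of the estimate.\<close>

definition levels :: "nat \<Rightarrow> nat" where
  "levels k = 2 * nat \<lceil>log 2 (real k + 1)\<rceil> + 2"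

lemma log_Suc_nonneg: "0 \<le> log 2 (real k + 1)"
  by simp

text \<open>A linear bound suffices for the choice of the exponent: with \<open>s\<close> of order
  \<open>1 / 2 ^ k\<close>, the factor \<open>t powr (- s)\<close> stays bounded for all levels
  \<open>t\<close> in use.\<close>

lemma levels_le: "levels k \<le> 2 * k + 2"
proof -
  have "real k + 1 \<le> 2 ^ k"
    by (induction k) auto
  then have "log 2 (real k + 1) \<le> log 2 (2 ^ k)"
    by (subst log_le_cancel_iff) auto
  then have "\<lceil>log 2 (real k + 1)\<rceil> \<le> int k"
    by (simp add: ceiling_le_iff)
  then show ?thesis
    unfolding levels_def by (simp add: nat_le_iff del: ceiling_le_iff)
qed

lemma levels_le_log: "real (levels k) \<le> 2 * log 2 (real k + 1) + 4"
proof -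
  have "real (nat \<lceil>log 2 (real k + 1)\<rceil>) = of_int \<lceil>log 2 (real k + 1)\<rceil>"
    using log_Suc_nonneg[of k] by (intro of_nat_nat) linarith
  also have "\<dots> \<le> log 2 (real k + 1) + 1"
    by linarith
  finally show ?thesis
    unfolding levels_def by (simp, linarith)
qed

lemma half_power_levels: "(1/2::real) ^ levels k \<le> 1 / (4 * (real k + 1)\<^sup>2)"
proof -
  let ?c = "nat \<lceil>log 2 (real k + 1)\<rceil>"
  have "real k + 1 = 2 powr (log 2 (real k + 1))"
    by simp
  also have "\<dots> \<le> 2 powr real ?c"
    by (intro powr_mono) linarith+
  also have "\<dots> = 2 ^ ?c"
    by (rule powr_realpow) simp
  finally have "(real k + 1)\<^sup>2 \<le> (2 ^ ?c)\<^sup>2"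
    by (intro power_mono) auto
  also have "4 * \<dots> = (2::real) ^ levels k"
    unfolding levels_def by (simp add: power_add power_mult power2_eq_square power_mult_distrib[symmetric])
  finally have "4 * (real k + 1)\<^sup>2 \<le> 2 ^ levels k" by simp
  then show ?thesis
    by (simp add: power_divide frac_le)
qed

lemma sum_half_power_levels: "(\<Sum>k<n. (1/2::real) ^ levels k) \<le> 1/2"
proof -
  \<comment> \<open>The subtracted term makes the sum telescope, by
    \<open>1 / (n + 1)\<^sup>2 + 1 / (n + 1) \<le> 1 / n\<close>.\<close>
  have tel: "(\<Sum>k<n. 1 / (4 * (real k + 1)\<^sup>2)) \<le> 1/2 - 1 / (4 * real n)" if "n \<ge> 1" for n
    using that
  proof (induction n rule: nat_induct_at_least)
    case base
    then show ?case by simp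
  next
    case (Suc n)
    have "1 / (4 * (real n + 1)\<^sup>2) + 1 / (4 * (real n + 1)) \<le> 1 / (4 * real n)"
      using Suc.hyps by (simp add: divide_simps power2_eq_square) (simp add: algebra_simps)
    then show ?case
      using Suc by (simp add: add.commute)
  qed
  show ?thesis
  proof (cases "n \<ge> 1")
    case True
    have "(\<Sum>k<n. (1/2::real) ^ levels k) \<le> (\<Sum>k<n. 1 / (4 * (real k + 1)\<^sup>2))"
      by (intro sum_mono half_power_levels)
    also have "\<dots> \<le> 1/2 - 1 / (4 * real n)"
      by (rule tel[OF True])
    also have "\<dots> \<le> 1/2" by simp
    finally show ?thesis .
  next
    case False
    then have "n = 0" by simp
    then show ?thesis by simp
  qed
qed

text \<open>Replaces a value by finitely many indicators, so that Chebyshev's inequality later calls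
  for the weak type bound at the levels \<open>(1/2) ^ Suc i\<close> alone. The weight is the upper
  end of the dyadic interval whose lower end is the threshold; this makes the sum dominate
  \<open>min a 1\<close> up to \<open>(1/2) ^ n\<close>.\<close>

definition dyadic_part :: "nat \<Rightarrow> real \<Rightarrow> real" where
  "dyadic_part n a = (\<Sum>i<n. (1/2) ^ i * (if (1/2) ^ Suc i < a then 1 else 0))"

lemma dyadic_part_nonneg: "0 \<le> dyadic_part n a"
  unfolding dyadic_part_def by (intro sum_nonneg) auto

lemma dyadic_part_bound: "min a 1 \<le> (1/2) ^ n + dyadic_part n a"
proof (induction n)
  case 0
  then show ?case by (simp add: dyadic_part_def)
next
  case (Suc n)
  show ?case
  proof (cases "(1/2) ^ Suc n < a")
    case True
    then have "dyadic_part (Suc n) a = dyadic_part n a + (1/2) ^ n"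
      by (simp add: dyadic_part_def)
    moreover have "(0::real) \<le> (1/2) ^ Suc n" by simp
    ultimately show ?thesis
      using Suc by linarith
  next
    case False
    then show ?thesis
      using dyadic_part_nonneg[of "Suc n" a] by linarith
  qed
qed

text \<open>Capping the terms at 1 does no harm: either one term reaches 1, or no cap is active. The
  errors \<open>(1/2) ^ levels k\<close> take away at most 1/2.\<close>

lemma sum_dyadic_part:
  assumes a: "\<And>k. k < n \<Longrightarrow> 0 \<le> a k" and s: "1 < (\<Sum>k<n. a k)"
  shows "1/2 \<le> (\<Sum>k<n. dyadic_part (levels k) (a k))"
proof -
  have "1 \<le> (\<Sum>k<n. min (a k) 1)"
  proof (cases "\<exists>k<n. 1 \<le> a k")
    case True
    then obtain k where k: "k < n" "1 \<le> a k" by blast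
    then have "1 = min (a k) 1" by simp
    also have "\<dots> \<le> (\<Sum>k<n. min (a k) 1)"
      using k a by (intro member_le_sum) auto
    finally show ?thesis .
  next
    case False
    then have "(\<Sum>k<n. min (a k) 1) = (\<Sum>k<n. a k)"
      by (intro sum.cong) auto
    then show ?thesis using s by simp
  qed
  also have "\<dots> \<le> (\<Sum>k<n. (1/2) ^ levels k + dyadic_part (levels k) (a k))"
    by (intro sum_mono dyadic_part_bound)
  also have "\<dots> = (\<Sum>k<n. (1/2) ^ levels k) + (\<Sum>k<n. dyadic_part (levels k) (a k))"
    by (rule sum.distrib)
  finally show ?thesis
    using sum_half_power_levels[of n] by simp
qed

text \<open>The sign is kept, so that the pieces of a function add up to it. Piece 0 has no lower
  cut and takes all values of modulus at most 4.\<close>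

definition piece :: "nat \<Rightarrow> real \<Rightarrow> real" where
  "piece k v = (if (k = 0 \<or> 2 ^ 2 ^ k < \<bar>v\<bar>) \<and> \<bar>v\<bar> \<le> 2 ^ 2 ^ Suc k then v else 0)"

lemma sum_piece:
  assumes "1 \<le> n" "\<bar>v\<bar> \<le> 2 ^ 2 ^ n"
  shows "(\<Sum>k<n. piece k v) = v"
  using assms
proof (induction n rule: nat_induct_at_least)
  case base
  then show ?case by (simp add: piece_def)
next
  case (Suc n)
  show ?case
  proof (cases "\<bar>v\<bar> \<le> 2 ^ 2 ^ n")
    case True
    then show ?thesis
      using Suc by (simp add: piece_def)
  next
    case False
    have "piece k v = 0" if "k < n" for k
    proof -
      have "(2::real) ^ 2 ^ Suc k \<le> 2 ^ 2 ^ n"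
        using that by (intro power_increasing) auto
      then have "\<not> \<bar>v\<bar> \<le> 2 ^ 2 ^ Suc k"
        using False by linarith
      then show ?thesis
        unfolding piece_def by (simp only: simp_thms if_False)
    qed
    then show ?thesis
      using Suc False by (simp add: piece_def)
  qed
qed

lemma abs_piece: "\<bar>piece k v\<bar> = piece k \<bar>v\<bar>"
  by (simp add: piece_def)

lemma abs_piece_le: "\<bar>piece k v\<bar> \<le> \<bar>v\<bar>" "\<bar>piece k v\<bar> \<le> 2 ^ 2 ^ Suc k"
  by (auto simp: piece_def)

lemma piece_measurable [measurable]: "piece k \<in> borel_measurable borel"
  unfolding piece_def by measurable

text \<open>For \<open>k > 0\<close>, repeated logarithms turn the lower cut
  \<open>2 ^ 2 ^ k\<close> into \<open>2 ^ k\<close>, \<open>k\<close> and \<open>log 2 k\<close>.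
  Thus the weight \<open>2 powr (m * k)\<close> becomes the power of the logarithm and
  \<open>levels k\<close> the triple logarithm \<open>l\<close>; the 6 comes from
  \<open>2 * (1 + l) + 4 \<le> 6 * (1 + l)\<close>.\<close>

lemma weighted_piece_le:
  assumes m: "0 < m"
  shows "real (levels k) * 2 powr (m * k) * \<bar>piece k v\<bar>
    \<le> 6 * ((1 + logp \<bar>v\<bar>) powr m * (1 + logp (logp (logp \<bar>v\<bar>)))) * \<bar>piece k v\<bar>"
proof (cases "piece k v = 0")
  case False
  note one = one_le_factors[OF m, of "\<bar>v\<bar>"]
  have "real (levels k) * 2 powr (m * k)
      \<le> (6 * (1 + logp (logp (logp \<bar>v\<bar>)))) * (1 + logp \<bar>v\<bar>) powr m"
  proof (cases "k = 0")
    case True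
    then have "real (levels k) * 2 powr (m * k) = 2 * 1"
      by (simp add: levels_def)
    also have "\<dots> \<le> (6 * (1 + logp (logp (logp \<bar>v\<bar>)))) * (1 + logp \<bar>v\<bar>) powr m"
      using one by (intro mult_mono) auto
    finally show ?thesis .
  next
    case k: False
    then have v: "2 ^ 2 ^ k < \<bar>v\<bar>"
      using False by (auto simp: piece_def split: if_splits)
    then have "log 2 (2 ^ 2 ^ k) \<le> log 2 \<bar>v\<bar>"
      by (intro log_mono) auto
    also have "\<dots> \<le> logp \<bar>v\<bar>"
      using v by (intro logp_ge) (auto intro: less_trans[of 0 "2 ^ 2 ^ k"])
    finally have l1: "2 ^ k \<le> logp \<bar>v\<bar>"
      by simp
    then have "log 2 (2 ^ k) \<le> log 2 (logp \<bar>v\<bar>)"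
      by (intro log_mono) auto
    also have "\<dots> \<le> logp (logp \<bar>v\<bar>)"
      using l1 by (intro logp_ge) (auto intro: less_le_trans[of 0 "2 ^ k"])
    finally have l2: "real k \<le> logp (logp \<bar>v\<bar>)"
      by simp
    then have "log 2 (real k) \<le> log 2 (logp (logp \<bar>v\<bar>))"
      using k by (intro log_mono) auto
    also have "\<dots> \<le> logp (logp (logp \<bar>v\<bar>))"
      using l2 k by (intro logp_ge) auto
    finally have l3: "log 2 (real k) \<le> logp (logp (logp \<bar>v\<bar>))" .
    have "log 2 (real k + 1) \<le> log 2 (2 * real k)"
      using k by (intro log_mono) auto
    also have "\<dots> = 1 + log 2 (real k)"
      using k by (simp add: log_mult)
    finally have l4: "log 2 (real k + 1) \<le> 1 + log 2 (real k)" .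
    define l where "l = logp (logp (logp \<bar>v\<bar>))"
    have "0 \<le> l"
      unfolding l_def by (rule logp_nonneg)
    then have "real (levels k) \<le> 6 * (1 + l)"
      using levels_le_log[of k] l3[folded l_def] l4 by simp
    then have "real (levels k) \<le> 6 * (1 + logp (logp (logp \<bar>v\<bar>)))"
      unfolding l_def .
    moreover have "2 powr (m * k) \<le> (1 + logp \<bar>v\<bar>) powr m"
    proof -
      have "2 powr (m * k) = (2 ^ k) powr m"
        by (simp add: powr_powr powr_realpow[symmetric] mult.commute)
      also have "\<dots> \<le> (1 + logp \<bar>v\<bar>) powr m"
        using m l1 by (intro powr_mono2) auto
      finally show ?thesis .
    qed
    ultimately show ?thesis
      using one by (intro mult_mono) auto
  qed
  then have "real (levels k) * 2 powr (m * k) * \<bar>piece k v\<bar>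
      \<le> (6 * (1 + logp (logp (logp \<bar>v\<bar>)))) * (1 + logp \<bar>v\<bar>) powr m * \<bar>piece k v\<bar>"
    by (intro mult_right_mono) auto
  then show ?thesis
    by (simp only: mult_ac)
qed simp

lemma sum_weighted_piece_le:
  assumes m: "0 < m" and n: "1 \<le> n" "\<bar>v\<bar> \<le> 2 ^ 2 ^ n"
  shows "(\<Sum>k<n. real (levels k) * 2 powr (m * k) * \<bar>piece k v\<bar>) \<le> 6 * antonov_phi m \<bar>v\<bar>"
proof -
  have "(\<Sum>k<n. real (levels k) * 2 powr (m * k) * \<bar>piece k v\<bar>)
      \<le> (\<Sum>k<n. 6 * ((1 + logp \<bar>v\<bar>) powr m * (1 + logp (logp (logp \<bar>v\<bar>)))) * \<bar>piece k v\<bar>)"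
    by (intro sum_mono weighted_piece_le[OF m])
  also have "\<dots> = 6 * ((1 + logp \<bar>v\<bar>) powr m * (1 + logp (logp (logp \<bar>v\<bar>)))) * (\<Sum>k<n. piece k \<bar>v\<bar>)"
    by (simp add: sum_distrib_left abs_piece)
  also have "(\<Sum>k<n. piece k \<bar>v\<bar>) = \<bar>v\<bar>"
    using n by (intro sum_piece) auto
  finally show ?thesis
    by (simp add: antonov_phi_def mult_ac)
qed

text \<open>The exponent \<open>p = 1 + s\<close> with \<open>s\<close> of order \<open>2\<^sup>-\<^sup>k\<close> keeps the \<open>s\<close>-th power of the height
  \<open>2 ^ 2 ^ (k + 1)\<close> bounded.\<close>

lemma exponent_choice_bound:
  fixes m s0 B0 C :: real
  assumes s0: "0 < s0" "s0 \<le> 1" and B0: "1 \<le> B0" "C \<le> B0 * s0" "0 < C" and m: "0 < m"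
    and i: "i \<le> 2 * k + 1"
  defines "s \<equiv> s0 / 2 ^ k"
  shows "(C / s) powr (m * (1 + s)) * ((1/2) ^ Suc i / (2 * 2 ^ 2 ^ Suc k)) powr (- (1 + s)) / 2 ^ 2 ^ Suc k
    \<le> B0 powr (2 * m) * 2 powr m * 256 * 2 powr (m * k) * 2 ^ Suc i"
proof -
  have k: "real k \<le> 2 ^ k"
    by (rule less_imp_le[OF of_nat_less_two_power])
  have s: "0 < s" "s * 2 ^ k \<le> 1"
    using s0 by (auto simp: s_def)
  have sk: "s * k \<le> 1"
    using s by (intro order_trans[OF mult_left_mono[OF k] s(2)]) simp
  have s1: "s \<le> 1"
    using s order_trans[OF mult_left_mono[of 1 "2 ^ k" s] s(2)] by simp
  note s = s sk s1 sk[unfolded mult.commute[of s]]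
  \<comment> \<open>\<open>C / s\<close> is at most \<open>B0 * 2 ^ k\<close>. Because of
    \<open>s * k \<le> 1\<close>, the excess exponent \<open>m * s\<close> costs at most
    \<open>2 powr m\<close> on \<open>2 ^ k\<close>, and because of \<open>s \<le> 1\<close> at most
    \<open>B0 powr m\<close> on \<open>B0\<close>.\<close>
  have 1: "(C / s) powr (m * (1 + s)) \<le> B0 powr (2 * m) * 2 powr m * 2 powr (m * k)"
  proof -
    have "C / s \<le> B0 * 2 ^ k"
      using B0 s0 by (simp add: s_def field_simps)
    then have "(C / s) powr (m * (1 + s)) \<le> (B0 * 2 powr k) powr (m * (1 + s))"
      using B0 s m by (intro powr_mono2) (auto simp: powr_realpow)
    also have "\<dots> = B0 powr (m * (1 + s)) * 2 powr (k * (m * (1 + s)))"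
      using B0 by (simp add: powr_mult powr_powr)
    also have "\<dots> \<le> B0 powr (2 * m) * 2 powr (m + m * k)"
    proof (rule mult_mono)
      have "m * (1 + s) \<le> 2 * m" using m s by simp
      then show "B0 powr (m * (1 + s)) \<le> B0 powr (2 * m)"
        using B0 by (intro powr_mono) auto
      have "m * (k * s) \<le> m * 1" using m s by (intro mult_left_mono) auto
      then have "k * (m * (1 + s)) \<le> m + m * k" by (simp add: algebra_simps)
      then show "2 powr (k * (m * (1 + s))) \<le> 2 powr (m + m * k)"
        by (intro powr_mono) auto
    qed auto
    finally show ?thesis by (simp add: powr_add)
  qed
  have 2: "((1/2) ^ Suc i / (2 * 2 ^ 2 ^ Suc k)) powr (- (1 + s)) / 2 ^ 2 ^ Suc k \<le> 256 * (2::real) ^ Suc i"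
  proof -
    \<comment> \<open>The base is \<open>2 powr (- e)\<close>: the summands of \<open>e\<close>
      stand for the level, for the factor 2 in the denominator and for the height.\<close>
    define e where "e = real (Suc i) + 1 + 2 ^ Suc k"
    have r: "(2::real) ^ 2 ^ Suc k = 2 powr (2 ^ Suc k)"
      using powr_realpow[of "2::real" "2 ^ Suc k"] by simp
    have b: "(1/2::real) ^ Suc i / (2 * 2 ^ 2 ^ Suc k) = 2 powr (- e)"
    proof -
      have "2 powr e = 2 powr real (Suc i) * 2 powr 1 * 2 powr (2 ^ Suc k)"
        unfolding e_def by (simp only: powr_add)
      also have "2 powr real (Suc i) = (2::real) ^ Suc i"
        by (rule powr_realpow) simp
      finally show ?thesis
        unfolding r powr_minus_divide by (simp add: power_one_over)
    qed
    have "(2 powr (- e)) powr (- (1 + s)) / 2 powr (2 ^ Suc k) = 2 powr (e * (1 + s) - 2 ^ Suc k)"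
      by (simp only: powr_powr powr_diff minus_mult_minus)
    also have "e * (1 + s) - 2 ^ Suc k = real (Suc i) + 1 + s * e"
      unfolding e_def by (simp add: algebra_simps)
    \<comment> \<open>The restriction on \<open>i\<close> enters here. The three terms contribute at
      most 2, 3 and 2; with the summand 1 left over in the exponent this makes
      \<open>2 ^ 8 = 256\<close>.\<close>
    also have "s * e \<le> 7"
    proof -
      have "e \<le> 2 * k + 3 + 2 * 2 ^ k"
        unfolding e_def using i by simp
      then have "s * e \<le> s * (2 * k + 3 + 2 * 2 ^ k)"
        using s by (intro mult_left_mono) auto
      also have "\<dots> = 2 * (s * k) + 3 * s + 2 * (s * 2 ^ k)"
        by (simp add: algebra_simps)
      also have "\<dots> \<le> 7" using s by linarith
      finally show ?thesis .
    qed
    then have "2 powr (real (Suc i) + 1 + s * e) \<le> 2 powr (real (Suc i) + 8)"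
      by (intro powr_mono) auto
    also have "\<dots> = 256 * 2 ^ Suc i"
      by (simp add: powr_add powr_realpow)
    finally show ?thesis
      unfolding b unfolding r .
  qed
  have "(C / s) powr (m * (1 + s)) * (((1/2) ^ Suc i / (2 * 2 ^ 2 ^ Suc k)) powr (- (1 + s)) / 2 ^ 2 ^ Suc k)
      \<le> (B0 powr (2 * m) * 2 powr m * 2 powr (m * k)) * (256 * 2 ^ Suc i)"
    using 1 2 by (intro mult_mono) auto
  then show ?thesis
    by (simp add: mult_ac)
qed

section \<open>Haar measure, inversion and convolution\<close>

locale haar_group =
  fixes M :: "'a::{topological_group_add, t2_space} measure"
  assumes locally_compact: "locally_compact_space (euclidean :: 'a topology)"
    and sigma_compact: "sigma_compact (UNIV :: 'a set)"
    and non_discrete: "(euclidean :: 'a topology) \<noteq> discrete_topology UNIV"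
    and haar: "left_haar_measure M"
begin

section \<open>Exhaustion, regularity and left translations\<close>

lemma sets_M [simp, measurable_cong]: "sets M = sets borel"
  using haar by (simp add: left_haar_measure_def)

lemma space_M [simp]: "space M = UNIV"
  using sets_eq_imp_space_eq[OF sets_M] by simp

lemma measurable_M: "borel_measurable M = borel_measurable borel"
  by (rule measurable_cong_sets) simp_all

lemma continuous_measurable_M:
  fixes g :: "'a \<Rightarrow> 'b::topological_space"
  assumes "continuous_on UNIV g"
  shows "g \<in> borel_measurable M"
  using borel_measurable_continuous_onI[OF assms] by (simp add: measurable_M)

lemma continuous_measurable_M_M:
  fixes g :: "'a \<Rightarrow> 'a"
  assumes "continuous_on UNIV g"
  shows "g \<in> measurable M M"
proof -
  have "measurable M M = borel_measurable borel"
    by (rule measurable_cong_sets) simp_all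
  then show ?thesis
    using borel_measurable_continuous_onI[OF assms] by simp
qed

lemma compact_sets: "compact (K::'a set) \<Longrightarrow> K \<in> sets M"
  by (simp add: compact_imp_closed)

lemma compact_finite: "compact K \<Longrightarrow> emeasure M K < \<infinity>"
  using haar by (simp add: left_haar_measure_def)

lemma exhaustion:
  obtains K :: "nat \<Rightarrow> 'a set" where "\<And>n. compact (K n)" "incseq K" "(\<Union>n. K n) = UNIV"
proof -
  obtain K :: "nat \<Rightarrow> 'a set" where K: "\<And>n. compact (K n)" "(\<Union>n. K n) = UNIV"
    using sigma_compact unfolding sigma_compact_def by auto
  define L where "L n = (\<Union>i\<le>n. K i)" for n
  have "compact (L n)" for n
    unfolding L_def by (intro compact_UN) (auto simp: K)
  moreover have "incseq L"
    unfolding L_def incseq_def by fastforce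
  moreover have "(\<Union>n. L n) = UNIV"
    using K(2) unfolding L_def by auto
  ultimately show ?thesis
    using that by blast
qed

sublocale sigma_finite_measure M
proof
  obtain K :: "nat \<Rightarrow> 'a set" where K: "\<And>n. compact (K n)" "(\<Union>n. K n) = UNIV"
    using exhaustion by metis
  show "\<exists>A. countable A \<and> A \<subseteq> sets M \<and> \<Union>A = space M \<and> (\<forall>a\<in>A. emeasure M a \<noteq> \<infinity>)"
    using K compact_sets compact_finite
    by (intro exI[of _ "range K"]) (auto simp: less_top[symmetric])
qed

sublocale pair: pair_sigma_finite M M ..

lemma outer_regular:
  assumes "A \<in> sets M" "emeasure M A < a"
  obtains U where "open U" "A \<subseteq> U" "emeasure M U < a"
proof -
  have "(INF U\<in>{U. open U \<and> A \<subseteq> U}. emeasure M U) < a"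
    using haar assms by (auto simp: left_haar_measure_def)
  then show ?thesis
    using that by (auto simp: INF_less_iff)
qed

lemma inner_regular_open:
  assumes "open U"
  shows "emeasure M U = (SUP K\<in>{K. compact K \<and> K \<subseteq> U}. emeasure M K)"
  using haar assms by (auto simp: left_haar_measure_def)

lemma distr_translate: "distr M M (\<lambda>y. x + y) = M"
proof (rule measure_eqI)
  fix A assume "A \<in> sets (distr M M (\<lambda>y. x + y))"
  then have A: "A \<in> sets M" by simp
  have m: "(\<lambda>y. x + y) \<in> measurable M M"
    by (intro continuous_measurable_M_M continuous_intros)
  have eq: "(\<lambda>y. x + y) -` A = (\<lambda>y. - x + y) ` A"
    by (force simp: add.assoc[symmetric])
  have "emeasure (distr M M (\<lambda>y. x + y)) A = emeasure M ((\<lambda>y. x + y) -` A)"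
    using A m by (simp add: emeasure_distr)
  also have "\<dots> = emeasure M A"
    unfolding eq using haar A by (auto simp: left_haar_measure_def)
  finally show "emeasure (distr M M (\<lambda>y. x + y)) A = emeasure M A" .
qed simp

lemma nn_integral_translate:
  assumes "f \<in> borel_measurable M"
  shows "(\<integral>\<^sup>+y. f (x + y) \<partial>M) = (\<integral>\<^sup>+y. f y \<partial>M)"
proof -
  have m: "(\<lambda>y. x + y) \<in> measurable M M"
    by (intro continuous_measurable_M_M continuous_intros)
  show ?thesis
    using nn_integral_distr[OF m, of f] assms by (simp add: distr_translate)
qed

section \<open>Compact neighbourhoods and Urysohn functions\<close>

lemma compact_neighbourhood:
  obtains U K where "open U" "compact K" "(x::'a) \<in> U" "U \<subseteq> K"
proof -
  have "\<exists>U. open U \<and> (\<exists>K. compact K \<and> x \<in> U \<and> U \<subseteq> K)"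
    using locally_compact unfolding locally_compact_space_def by auto
  then show ?thesis
    using that by blast
qed

lemma compact_open_superset:
  assumes "compact (Q::'a set)"
  obtains V K where "open V" "compact K" "Q \<subseteq> V" "V \<subseteq> K"
proof -
  have "\<exists>U K. open U \<and> compact K \<and> (x::'a) \<in> U \<and> U \<subseteq> K" for x
    using compact_neighbourhood by metis
  then obtain U K where UK: "\<And>x::'a. open (U x) \<and> compact (K x) \<and> x \<in> U x \<and> U x \<subseteq> K x"
    by metis
  obtain D where D: "D \<subseteq> Q" "finite D" "Q \<subseteq> (\<Union>x\<in>D. U x)"
    using compactE_image[OF assms, of Q U] UK by blast
  show ?thesis
  proof (rule that)
    show "open (\<Union>x\<in>D. U x)" using UK by auto
    show "compact (\<Union>x\<in>D. K x)" using UK D by (intro compact_UN) auto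
    show "(\<Union>x\<in>D. U x) \<subseteq> (\<Union>x\<in>D. K x)" using UK by auto
  qed (use D in auto)
qed

lemma Urysohn_compact_open:
  assumes "compact (K::'a set)" "open U" "K \<subseteq> U"
  obtains g :: "'a \<Rightarrow> real" where "continuous_on UNIV g" "\<And>x. 0 \<le> g x" "\<And>x. g x \<le> 1"
    "\<And>x. x \<in> K \<Longrightarrow> g x = 1" "\<And>x. x \<notin> U \<Longrightarrow> g x = 0"
proof -
  have "Hausdorff_space (euclidean::'a topology)"
    unfolding Hausdorff_space_def using hausdorff by (fastforce simp: disjnt_def)
  then have "completely_regular_space (euclidean::'a topology)"
    using locally_compact locally_compact_regular_imp_completely_regular_space by blast
  then obtain f where f: "continuous_map euclidean (top_of_set {0..1::real}) f"
    "f ` (- U) \<subseteq> {0}" "f ` K \<subseteq> {1}"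
    using Urysohn_completely_regular_compact_closed[of 0 1 euclidean K "- U"] assms
    by (auto simp: disjnt_def)
  show ?thesis
    by (rule that[of f]) (use f in \<open>auto simp: continuous_map_in_subtopology image_subset_iff\<close>)
qed

text \<open>The Borel sets of the square may form a larger \<open>\<sigma>\<close>-algebra than the product of the
  Borel \<open>\<sigma>\<close>-algebras, so Fubini's theorem is available for continuous integrands but not for all
  Borel ones.\<close>

lemma continuous_measurable_pair:
  fixes F :: "'a \<times> 'a \<Rightarrow> real"
  assumes F: "continuous_on UNIV F"
  shows "F \<in> borel_measurable (M \<Otimes>\<^sub>M M)"
proof (rule borel_measurableI_greater)
  fix a :: real
  obtain K :: "nat \<Rightarrow> 'a set" where K: "\<And>n. compact (K n)" "incseq K" "(\<Union>n. K n) = UNIV"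
    using exhaustion by metis
  let ?W = "{z. a < F z}"
  have W: "open ?W"
    using F by (intro open_Collect_less continuous_intros)
  \<comment> \<open>Finitely many open rectangles inside \<open>?W\<close> cover a compact subset of
    \<open>?W\<close>, and their union is measurable for the product.\<close>
  have rect: "\<exists>R\<in>sets (M \<Otimes>\<^sub>M M). C \<subseteq> R \<and> R \<subseteq> ?W" if C: "compact C" "C \<subseteq> ?W" for C
  proof -
    have "\<exists>A B. open A \<and> open B \<and> z \<in> A \<times> B \<and> A \<times> B \<subseteq> ?W" if "z \<in> C" for z
      using open_prod_elim[OF W] C that by (metis subsetD)
    then obtain A B where AB: "\<And>z. z \<in> C \<Longrightarrow> open (A z) \<and> open (B z) \<and> z \<in> A z \<times> B z \<and> A z \<times> B z \<subseteq> ?W"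
      by metis
    obtain D where D: "D \<subseteq> C" "finite D" "C \<subseteq> (\<Union>z\<in>D. A z \<times> B z)"
      by (rule compactE_image[OF C(1), of C "\<lambda>z. A z \<times> B z"]) (use AB in \<open>auto intro!: open_Times\<close>)
    have "(\<Union>z\<in>D. A z \<times> B z) \<in> sets (M \<Otimes>\<^sub>M M)"
      using D AB by (intro sets.finite_UN) auto
    moreover have "(\<Union>z\<in>D. A z \<times> B z) \<subseteq> ?W"
    proof (rule UN_least)
      fix z assume "z \<in> D"
      then show "A z \<times> B z \<subseteq> ?W"
        using D(1) AB[of z] by auto
    qed
    ultimately show ?thesis
      using D(3) by (intro bexI[of _ "\<Union>z\<in>D. A z \<times> B z"] conjI)
  qed
  \<comment> \<open>Countably many compact sets exhaust \<open>?W\<close>: the sets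
    \<open>K n\<close> confine the arguments, and the margin \<open>1 / Suc m\<close> makes the sets
    closed.\<close>
  define C where "C n m = {z. a + 1 / Suc m \<le> F z} \<inter> (K n \<times> K n)" for n m :: nat
  have "closed {z. a + 1 / Suc m \<le> F z}" for m :: nat
    using F by (intro closed_Collect_le continuous_intros)
  then have C1: "compact (C n m)" for n m
    unfolding C_def using K by (intro closed_Int_compact compact_Times) auto
  have C2: "C n m \<subseteq> ?W" for n m
  proof -
    have "a < a + 1 / Suc m" by simp
    then show ?thesis
      unfolding C_def by (blast intro: less_le_trans)
  qed
  define R where "R n m = (SOME R. R \<in> sets (M \<Otimes>\<^sub>M M) \<and> C n m \<subseteq> R \<and> R \<subseteq> ?W)" for n m
  have R': "R n m \<in> sets (M \<Otimes>\<^sub>M M) \<and> C n m \<subseteq> R n m \<and> R n m \<subseteq> ?W" for n m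
    unfolding R_def by (rule someI_ex) (rule rect[OF C1 C2, unfolded Bex_def])
  note R = R'[THEN conjunct1] R'[THEN conjunct2, THEN conjunct1] R'[THEN conjunct2, THEN conjunct2]
  have "?W \<subseteq> (\<Union>n m. C n m)"
  proof
    fix z assume "z \<in> ?W"
    then have "0 < F z - a" by simp
    then obtain m where m: "1 / Suc m < F z - a"
      using nat_approx_posE by blast
    obtain n1 n2 where "fst z \<in> K n1" "snd z \<in> K n2"
      using K(3) by blast
    moreover have "K n1 \<subseteq> K (max n1 n2)" "K n2 \<subseteq> K (max n1 n2)"
      by (intro incseqD[OF K(2)]; simp)+
    ultimately have "z \<in> K (max n1 n2) \<times> K (max n1 n2)"
      by (cases z) auto
    then have "z \<in> C (max n1 n2) m"
      using m unfolding C_def by auto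
    then show "z \<in> (\<Union>n m. C n m)" by blast
  qed
  also have "\<dots> \<subseteq> (\<Union>n m. R n m)"
    by (intro UN_mono R subset_refl)
  finally have "?W = (\<Union>n m. R n m)"
    by (intro equalityI UN_least R)
  also have "\<dots> \<in> sets (M \<Otimes>\<^sub>M M)"
    by (intro sets.countable_nat_UN image_subsetI R)
  finally show "{z \<in> space (M \<Otimes>\<^sub>M M). a < F z} \<in> sets (M \<Otimes>\<^sub>M M)"
    by (simp add: space_pair_measure)
qed

section \<open>Inversion on compact sets\<close>

lemma exists_compact_pos:
  obtains K where "compact K" "0 < emeasure M K"
proof -
  obtain K :: "nat \<Rightarrow> 'a set" where K: "\<And>n. compact (K n)" "incseq K" "(\<Union>n. K n) = UNIV"
    using exhaustion by metis
  have "\<exists>n. emeasure M (K n) \<noteq> 0"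
  proof (rule ccontr)
    assume "\<not> ?thesis"
    then have "emeasure M (\<Union>n. K n) = 0"
      using K compact_sets by (intro emeasure_UN_eq_0) auto
    then show False
      using K haar by (simp add: left_haar_measure_def)
  qed
  then show ?thesis
    using that K by (metis not_gr_zero)
qed

text \<open>This replaces the modular function. The double integral of \<open>a(y) g(y\<inverse>x)\<close> is
  \<open>(\<integral>a)(\<integral>g)\<close> on the one hand, and on the other hand, after a left translation of \<open>y\<close> by \<open>x\<close>,
  the integral of \<open>g(y\<inverse>)\<close> against the function \<open>\<integral>a(xy) dx\<close>, which is bounded away from zero on
  a compact set if \<open>a\<close> is 1 on a large set.\<close>

lemma inversion_bound:
  assumes Q: "compact Q"
  obtains c :: real where "0 \<le> c"
    "\<And>A. A \<in> sets M \<Longrightarrow> A \<subseteq> Q \<Longrightarrow> emeasure M (uminus ` A) \<le> ennreal c * emeasure M A"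
proof -
  \<comment> \<open>Outer regularity will replace \<open>A\<close> by larger open sets; these are
    cut down to \<open>V\<close> and so stay inside the compact set \<open>Q'\<close>.\<close>
  obtain V Q' where V: "open V" "compact Q'" "Q \<subseteq> V" "V \<subseteq> Q'"
    using compact_open_superset[OF Q] by metis
  obtain W where W: "compact W" "0 < emeasure M W"
    using exists_compact_pos by metis
  \<comment> \<open>\<open>P\<close> is where \<open>a\<close> has to be 1: it contains
    \<open>x + y\<close> for \<open>x\<close> in \<open>W\<close> and \<open>- y\<close> in
    \<open>Q'\<close>. The open set \<open>O'\<close> of finite measure keeps the integral of
    \<open>a\<close> finite.\<close>
  define P where "P = (\<lambda>(x, y). x + - y) ` (W \<times> Q')"
  have P: "compact P"
    unfolding P_def using W V
    by (intro compact_continuous_image compact_Times)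
       (auto simp: case_prod_beta intro!: continuous_intros)
  obtain O' where O': "open O'" "P \<subseteq> O'" "emeasure M O' < \<infinity>"
    using outer_regular[OF compact_sets[OF P] compact_finite[OF P]] by metis
  obtain a :: "'a \<Rightarrow> real" where a: "continuous_on UNIV a" "\<And>x. 0 \<le> a x" "\<And>x. a x \<le> 1"
    "\<And>x. x \<in> P \<Longrightarrow> a x = 1" "\<And>x. x \<notin> O' \<Longrightarrow> a x = 0"
    using Urysohn_compact_open[OF P O'(1,2)] by metis
  define I where "I = (\<integral>\<^sup>+y. ennreal (a y) \<partial>M)"
  have "I \<le> (\<integral>\<^sup>+y. indicator O' y \<partial>M)"
    unfolding I_def using a(3,5) by (intro nn_integral_mono) (auto simp: indicator_def)
  then have I: "I < \<infinity>"
    using O' by (simp add: le_less_trans)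
  define c where "c = enn2real (I / emeasure M W)"
  have c: "ennreal c = I / emeasure M W"
  proof -
    have "I / emeasure M W \<noteq> top"
      using I W(2) by (auto simp: ennreal_divide_eq_top_iff)
    then show ?thesis
      unfolding c_def by (simp add: less_top)
  qed
  \<comment> \<open>A compact set is compared with an open set around its reflection, because a
    continuous function fits in between and Fubini's theorem then meets continuous
    integrands.\<close>
  have key: "emeasure M C \<le> ennreal c * emeasure M U"
    if U: "open U" "U \<subseteq> V" and C: "compact C" "uminus ` C \<subseteq> U" for U C
  proof -
    have "compact (uminus ` C)"
      by (intro compact_continuous_image C continuous_intros)
    then obtain g :: "'a \<Rightarrow> real" where g: "continuous_on UNIV g" "\<And>x. 0 \<le> g x" "\<And>x. g x \<le> 1"
      "\<And>x. x \<in> uminus ` C \<Longrightarrow> g x = 1" "\<And>x. x \<notin> U \<Longrightarrow> g x = 0"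
      using Urysohn_compact_open U(1) C(2) by metis
    have [measurable]: "a \<in> borel_measurable M" "g \<in> borel_measurable M"
      using a g by (auto intro: continuous_measurable_M)
    have [measurable]: "(\<lambda>y. g (- y)) \<in> borel_measurable M"
      by (intro continuous_measurable_M continuous_on_compose2[OF g(1)] continuous_intros) auto
    have tr [measurable]: "(\<lambda>y. x + y) \<in> measurable M M" for x
      by (intro continuous_measurable_M_M continuous_intros)
    have mi [measurable]: "(\<lambda>y. - y) \<in> measurable M M"
      by (intro continuous_measurable_M_M continuous_intros)
    have 1: "(\<lambda>(y, x). a y * g (- y + x)) \<in> borel_measurable (M \<Otimes>\<^sub>M M)"
      unfolding case_prod_beta
      by (intro continuous_measurable_pair continuous_intros continuous_on_compose2[OF a(1)]
            continuous_on_compose2[OF g(1)]) auto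
    have 2: "(\<lambda>(x, y). a (x + y) * g (- y)) \<in> borel_measurable (M \<Otimes>\<^sub>M M)"
      unfolding case_prod_beta
      by (intro continuous_measurable_pair continuous_intros continuous_on_compose2[OF a(1)]
            continuous_on_compose2[OF g(1)]) auto
    have C': "emeasure M C * emeasure M W
        \<le> (\<integral>\<^sup>+y. (\<integral>\<^sup>+x. ennreal (a (x + y) * g (- y)) \<partial>M) \<partial>M)"
    proof -
      have "emeasure M C * emeasure M W = (\<integral>\<^sup>+y. emeasure M W * indicator C y \<partial>M)"
        unfolding nn_integral_cmult_indicator[OF compact_sets[OF C(1)]] by (simp add: mult.commute)
      also have "\<dots> \<le> (\<integral>\<^sup>+y. (\<integral>\<^sup>+x. ennreal (a (x + y) * g (- y)) \<partial>M) \<partial>M)"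
      proof (rule nn_integral_mono)
        fix y
        show "emeasure M W * indicator C y \<le> (\<integral>\<^sup>+x. ennreal (a (x + y) * g (- y)) \<partial>M)"
        proof (cases "y \<in> C")
          case True
          then have "g (- y) = 1"
            by (intro g(4)) auto
          moreover have "- y \<in> Q'"
            using True C U V by auto
          have "a (x + y) = 1" if "x \<in> W" for x
          proof (rule a(4))
            have "x + y = (\<lambda>(x, y). x + - y) (x, - y)" by simp
            then show "x + y \<in> P"
              unfolding P_def using that \<open>- y \<in> Q'\<close> by (intro image_eqI) auto
          qed
          moreover note \<open>\<And>x. x \<in> W \<Longrightarrow> a (x + y) = 1\<close>
          ultimately have "(\<integral>\<^sup>+x. indicator W x \<partial>M) \<le> (\<integral>\<^sup>+x. ennreal (a (x + y) * g (- y)) \<partial>M)"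
            by (intro nn_integral_mono) (auto simp: indicator_def)
          then show ?thesis
            using True compact_sets[OF W(1)] by simp
        qed simp
      qed
      finally show ?thesis .
    qed
    also have "\<dots> = (\<integral>\<^sup>+x. (\<integral>\<^sup>+y. ennreal (a (x + y) * g (- y)) \<partial>M) \<partial>M)"
      using pair.Fubini'[of "\<lambda>x y. ennreal (a (x + y) * g (- y))"] 2 by (simp add: case_prod_beta)
    also have "\<dots> = (\<integral>\<^sup>+x. (\<integral>\<^sup>+y. ennreal (a y * g (- y + x)) \<partial>M) \<partial>M)"
    proof (rule nn_integral_cong)
      fix x
      have m: "(\<lambda>y. ennreal (a y * g (- y + x))) \<in> borel_measurable M"
        by (intro measurable_compose[OF _ measurable_ennreal] continuous_measurable_M continuous_intros
              continuous_on_compose2[OF a(1)] continuous_on_compose2[OF g(1)]) auto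
      have "- (x + y) + x = - y" for y
        by (simp add: minus_add add.assoc)
      then show "(\<integral>\<^sup>+y. ennreal (a (x + y) * g (- y)) \<partial>M) = (\<integral>\<^sup>+y. ennreal (a y * g (- y + x)) \<partial>M)"
        using nn_integral_translate[OF m, of x] by simp
    qed
    also have "\<dots> = (\<integral>\<^sup>+y. (\<integral>\<^sup>+x. ennreal (a y * g (- y + x)) \<partial>M) \<partial>M)"
      using pair.Fubini'[of "\<lambda>y x. ennreal (a y * g (- y + x))"] 1 by (simp add: case_prod_beta)
    also have "\<dots> = (\<integral>\<^sup>+y. ennreal (a y) * (\<integral>\<^sup>+x. ennreal (g (- y + x)) \<partial>M) \<partial>M)"
      using a(2) g(2) tr by (simp add: ennreal_mult nn_integral_cmult measurable_compose[OF tr])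
    also have "\<dots> = I * (\<integral>\<^sup>+x. ennreal (g x) \<partial>M)"
      unfolding I_def using nn_integral_translate[of "\<lambda>x. ennreal (g x)"]
      by (simp add: nn_integral_multc)
    also have "\<dots> \<le> I * (\<integral>\<^sup>+x. indicator U x \<partial>M)"
      using g(3,5) by (intro mult_left_mono nn_integral_mono) (auto simp: indicator_def)
    also have "\<dots> = I * emeasure M U"
      using U(1) by simp
    finally have "emeasure M C * emeasure M W \<le> I * emeasure M U" .
    then have "(emeasure M C * emeasure M W) / emeasure M W \<le> (I * emeasure M U) / emeasure M W"
      by (rule divide_right_mono_ennreal)
    moreover have "emeasure M W < top"
      using compact_finite[OF W(1)] by simp
    ultimately show ?thesis
      using W(2) unfolding c
      by (simp add: ennreal_mult_divide_eq ennreal_times_divide mult.commute)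
  qed
  show ?thesis
  proof
    show "0 \<le> c" unfolding c_def by simp
    fix A assume A: "A \<in> sets M" "A \<subseteq> Q"
    \<comment> \<open>The reflection of \<open>U \<inter> V\<close> is open, so by inner regularity
      it suffices to apply \<open>key\<close> to its compact subsets. Outer regularity of
      \<open>A\<close> then removes \<open>U\<close>.\<close>
    have U: "emeasure M (uminus ` A) \<le> ennreal c * emeasure M U" if "open U" "A \<subseteq> U" for U
    proof -
      have inv: "uminus ` S = uminus -` S" for S :: "'a set"
        by force
      have "continuous_on UNIV (uminus :: 'a \<Rightarrow> 'a)"
        by (intro continuous_intros)
      then have o: "open (uminus ` (U \<inter> V))"
        unfolding inv using that V(1) by (intro open_vimage) auto
      have "emeasure M (uminus ` A) \<le> emeasure M (uminus ` (U \<inter> V))"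
        using that A V o by (intro emeasure_mono) auto
      also have "\<dots> \<le> ennreal c * emeasure M (U \<inter> V)"
        unfolding inner_regular_open[OF o]
        using that V(1) by (intro SUP_least key) force+
      also have "\<dots> \<le> ennreal c * emeasure M U"
        using that by (intro mult_left_mono emeasure_mono) auto
      finally show ?thesis .
    qed
    show "emeasure M (uminus ` A) \<le> ennreal c * emeasure M A"
    proof (rule ennreal_le_epsilon)
      fix e :: real assume fin: "ennreal c * emeasure M A < top" and e: "0 < e"
      show "emeasure M (uminus ` A) \<le> ennreal c * emeasure M A + ennreal e"
      proof (cases "emeasure M A < \<infinity>")
        case True
        define d where "d = e / (c + 1)"
        have d: "0 < d" "c * d \<le> e"
          using e \<open>0 \<le> c\<close> by (auto simp: d_def field_simps)
        have "emeasure M A < emeasure M A + ennreal d"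
          using True d by (simp add: ennreal_add_left_cancel_less[of _ 0, simplified] less_top)
        then obtain U where "open U" "A \<subseteq> U" "emeasure M U < emeasure M A + ennreal d"
          using outer_regular[OF A(1)] by metis
        then have "emeasure M (uminus ` A) \<le> ennreal c * (emeasure M A + ennreal d)"
          using U[of U] by (meson less_imp_le mult_left_mono order_trans zero_le)
        also have "\<dots> = ennreal c * emeasure M A + ennreal (c * d)"
          using d \<open>0 \<le> c\<close> by (simp add: distrib_left ennreal_mult)
        also have "\<dots> \<le> ennreal c * emeasure M A + ennreal e"
          using d by (intro add_left_mono ennreal_leI)
        finally show ?thesis .
      next
        case False
        then show ?thesis
          using emeasure_mono[OF A(2) compact_sets[OF Q]] compact_finite[OF Q] by (meson le_less_trans)
      qed
    qed
  qed
qed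

lemma uminus_measurable_M [measurable]: "uminus \<in> measurable M M"
  by (intro continuous_measurable_M_M continuous_intros)

lemma translate_measurable_M [measurable]: "(\<lambda>y. x + y) \<in> measurable M M"
  by (intro continuous_measurable_M_M continuous_intros)

lemma reflect_measurable_M [measurable]: "(\<lambda>y. - y + x) \<in> measurable M M"
  by (intro continuous_measurable_M_M continuous_intros)

lemma inversion_bound_nn_integral:
  assumes Q: "compact Q"
  obtains c :: real where "0 \<le> c"
    "\<And>u. u \<in> borel_measurable M \<Longrightarrow>
       (\<integral>\<^sup>+y. u (- y) * indicator Q (- y) \<partial>M) \<le> ennreal c * (\<integral>\<^sup>+y. u y \<partial>M)"
proof -
  obtain c :: real where c: "0 \<le> c"
    "\<And>A. A \<in> sets M \<Longrightarrow> A \<subseteq> Q \<Longrightarrow> emeasure M (uminus ` A) \<le> ennreal c * emeasure M A"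
    using inversion_bound[OF Q] by metis
  have [measurable]: "Q \<in> sets M"
    using Q by (rule compact_sets)
  have "(\<integral>\<^sup>+y. u (- y) * indicator Q (- y) \<partial>M) \<le> ennreal c * (\<integral>\<^sup>+y. u y \<partial>M)"
    if "u \<in> borel_measurable M" for u
    using that
  proof (induction u rule: borel_measurable_induct)
    case (cong f g)
    then have "f = g" by auto
    with cong show ?case by simp
  next
    case (set A)
    have inv: "uminus ` S = uminus -` S" for S :: "'a set"
      by force
    have "uminus -` (A \<inter> Q) \<inter> space M \<in> sets M"
      using set by (intro measurable_sets[OF uminus_measurable_M]) auto
    then have s: "uminus ` (A \<inter> Q) \<in> sets M"
      by (simp add: inv)
    have "(\<integral>\<^sup>+y. indicator A (- y) * indicator Q (- y) \<partial>M) = (\<integral>\<^sup>+y. indicator (uminus ` (A \<inter> Q)) y \<partial>M)"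
      by (intro nn_integral_cong) (auto simp: inv indicator_def)
    also have "\<dots> = emeasure M (uminus ` (A \<inter> Q))"
      using s by (rule nn_integral_indicator)
    also have "\<dots> \<le> ennreal c * emeasure M (A \<inter> Q)"
      using set by (intro c) auto
    also have "\<dots> \<le> ennreal c * emeasure M A"
      using set by (intro mult_left_mono emeasure_mono) auto
    finally show ?case
      using set by simp
  next
    case (mult u d)
    note [measurable] = mult.hyps(2)
    have "(\<integral>\<^sup>+y. d * u (- y) * indicator Q (- y) \<partial>M) = d * (\<integral>\<^sup>+y. u (- y) * indicator Q (- y) \<partial>M)"
      by (subst nn_integral_cmult[symmetric]) (auto simp: mult.assoc)
    also have "\<dots> \<le> d * (ennreal c * (\<integral>\<^sup>+y. u y \<partial>M))"
      by (intro mult_left_mono mult.IH) auto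
    also have "\<dots> = ennreal c * (\<integral>\<^sup>+y. d * u y \<partial>M)"
      by (subst nn_integral_cmult) (auto simp: mult.left_commute)
    finally show ?case .
  next
    case (add u v)
    note [measurable] = add.hyps(1,3)
    have "(\<integral>\<^sup>+y. (u (- y) + v (- y)) * indicator Q (- y) \<partial>M)
        = (\<integral>\<^sup>+y. u (- y) * indicator Q (- y) \<partial>M) + (\<integral>\<^sup>+y. v (- y) * indicator Q (- y) \<partial>M)"
      by (subst nn_integral_add[symmetric]) (auto simp: distrib_right)
    also have "\<dots> \<le> ennreal c * (\<integral>\<^sup>+y. u y \<partial>M) + ennreal c * (\<integral>\<^sup>+y. v y \<partial>M)"
      by (intro add_mono add.IH)
    also have "\<dots> = ennreal c * (\<integral>\<^sup>+y. v y + u y \<partial>M)"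
      by (subst nn_integral_add) (auto simp: distrib_left add.commute)
    finally show ?case by (simp add: add.commute)
  next
    case (seq U)
    note [measurable] = seq.hyps(1)
    have "(\<integral>\<^sup>+y. (SUP i. U i (- y)) * indicator Q (- y) \<partial>M)
        = (\<integral>\<^sup>+y. (SUP i. U i (- y) * indicator Q (- y)) \<partial>M)"
      by (simp add: SUP_mult_right_ennreal)
    also have "\<dots> = (SUP i. \<integral>\<^sup>+y. U i (- y) * indicator Q (- y) \<partial>M)"
      using seq.hyps(3) by (intro nn_integral_monotone_convergence_SUP)
        (auto simp: incseq_def le_fun_def intro!: mult_right_mono)
    also have "\<dots> \<le> ennreal c * (\<integral>\<^sup>+y. (SUP i. U i y) \<partial>M)"
      by (intro SUP_least order_trans[OF seq.IH] mult_left_mono nn_integral_mono SUP_upper) auto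
    finally show ?case
      by (simp add: image_comp)
  qed
  then show ?thesis
    using that c(1) by blast
qed

text \<open>Left translation by \<open>x\<close> turns \<open>- y + x\<close> into
  \<open>- y\<close>, and the condition \<open>x + y \<in> K\<close> forces \<open>- y\<close> into
  the compact set of all \<open>- k + l\<close>. Uniformity in \<open>x\<close> allows kernels to be
  perturbed in L1 at all points of \<open>L\<close> at once.\<close>

lemma kernel_bound_nn_integral:
  assumes K: "compact K" and L: "compact L"
  obtains c :: real where "0 \<le> c"
    "\<And>u x. u \<in> borel_measurable M \<Longrightarrow> x \<in> L \<Longrightarrow>
       (\<integral>\<^sup>+y. u (- y + x) * indicator K y \<partial>M) \<le> ennreal c * (\<integral>\<^sup>+y. u y \<partial>M)"
proof -
  define Q where "Q = (\<lambda>(k, l). - k + l) ` (K \<times> L)"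
  have Q: "compact Q"
    unfolding Q_def using K L
    by (intro compact_continuous_image compact_Times)
       (auto simp: case_prod_beta intro!: continuous_intros)
  obtain c :: real where c: "0 \<le> c"
    "\<And>u. u \<in> borel_measurable M \<Longrightarrow>
       (\<integral>\<^sup>+y. u (- y) * indicator Q (- y) \<partial>M) \<le> ennreal c * (\<integral>\<^sup>+y. u y \<partial>M)"
    using inversion_bound_nn_integral[OF Q] by metis
  have [measurable]: "K \<in> sets M"
    using K by (rule compact_sets)
  have "(\<integral>\<^sup>+y. u (- y + x) * indicator K y \<partial>M) \<le> ennreal c * (\<integral>\<^sup>+y. u y \<partial>M)"
    if [measurable]: "u \<in> borel_measurable M" and x: "x \<in> L" for u x
  proof -
    have m: "(\<lambda>y. u (- y + x) * indicator K y) \<in> borel_measurable M"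
      by measurable
    have r: "- (x + y) + x = - y" for y
      by (simp add: minus_add add.assoc)
    have "(\<integral>\<^sup>+y. u (- y + x) * indicator K y \<partial>M) = (\<integral>\<^sup>+y. u (- y) * indicator K (x + y) \<partial>M)"
      using nn_integral_translate[OF m, of x] by (simp add: r)
    also have "\<dots> \<le> (\<integral>\<^sup>+y. u (- y) * indicator Q (- y) \<partial>M)"
    proof (intro nn_integral_mono mult_left_mono)
      fix y
      have "- y \<in> Q" if "x + y \<in> K"
      proof -
        have "- y = (\<lambda>(k, l). - k + l) (x + y, x)" by (simp add: r)
        then show ?thesis
          unfolding Q_def using that x by (intro image_eqI) auto
      qed
      then show "indicator K (x + y) \<le> (indicator Q (- y) :: ennreal)"
        by (auto simp: indicator_def)
    qed auto
    also have "\<dots> \<le> ennreal c * (\<integral>\<^sup>+y. u y \<partial>M)"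
      by (intro c) auto
    finally show ?thesis .
  qed
  then show ?thesis
    using that c(1) by blast
qed

section \<open>Convolution of real functions\<close>

definition conv :: "('a \<Rightarrow> real) \<Rightarrow> ('a \<Rightarrow> real) \<Rightarrow> 'a \<Rightarrow> real" where
  "conv f k x = (\<integral>y. f y * k (- y + x) \<partial>M)"

text \<open>The constant depends on \<open>K\<close> and \<open>L\<close> alone. For bounded
  \<open>f\<close> supported in \<open>K\<close> the integral therefore converges at every point,
  not just almost everywhere, and depends on the kernel continuously in L1, uniformly on
  \<open>L\<close>.\<close>

lemma conv_bound:
  assumes K: "compact K" and L: "compact L"
  shows "\<exists>c\<ge>0. (\<forall>f b k x. f \<in> borel_measurable M \<longrightarrow> (\<forall>y. \<bar>f y\<bar> \<le> b * indicator K y) \<longrightarrow> 0 \<le> b \<longrightarrow>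
       integrable M k \<longrightarrow> x \<in> L \<longrightarrow>
       integrable M (\<lambda>y. f y * k (- y + x)) \<and> \<bar>conv f k x\<bar> \<le> b * c * (\<integral>y. \<bar>k y\<bar> \<partial>M))"
proof -
  obtain c :: real where c: "0 \<le> c"
    "\<And>u x. u \<in> borel_measurable M \<Longrightarrow> x \<in> L \<Longrightarrow>
       (\<integral>\<^sup>+y. u (- y + x) * indicator K y \<partial>M) \<le> ennreal c * (\<integral>\<^sup>+y. u y \<partial>M)"
    using kernel_bound_nn_integral[OF K L] by metis
  have [measurable]: "K \<in> sets M"
    using K by (rule compact_sets)
  have "integrable M (\<lambda>y. f y * k (- y + x)) \<and> \<bar>conv f k x\<bar> \<le> b * c * (\<integral>y. \<bar>k y\<bar> \<partial>M)"
    if f[measurable]: "f \<in> borel_measurable M" and fb: "\<And>y. \<bar>f y\<bar> \<le> b * indicator K y" and b: "0 \<le> b"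
      and k: "integrable M k" and x: "x \<in> L" for f b k x
  proof -
    have [measurable]: "k \<in> borel_measurable M"
      using k by auto
    have "(\<integral>\<^sup>+y. ennreal (norm (f y * k (- y + x))) \<partial>M)
        \<le> (\<integral>\<^sup>+y. ennreal b * (ennreal \<bar>k (- y + x)\<bar> * indicator K y) \<partial>M)"
    proof (rule nn_integral_mono)
      fix y
      have "norm (f y * k (- y + x)) \<le> (b * indicator K y) * \<bar>k (- y + x)\<bar>"
        by (auto simp: abs_mult intro!: mult_right_mono fb)
      also have "ennreal ((b * indicator K y) * \<bar>k (- y + x)\<bar>)
          = ennreal b * (ennreal \<bar>k (- y + x)\<bar> * indicator K y)"
        using b by (auto simp: indicator_def ennreal_mult)
      finally show "ennreal (norm (f y * k (- y + x)))
          \<le> ennreal b * (ennreal \<bar>k (- y + x)\<bar> * indicator K y)"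
        by (simp add: ennreal_leI)
    qed
    also have "\<dots> = ennreal b * (\<integral>\<^sup>+y. ennreal \<bar>k (- y + x)\<bar> * indicator K y \<partial>M)"
      by (intro nn_integral_cmult) auto
    also have "\<dots> \<le> ennreal b * (ennreal c * (\<integral>\<^sup>+y. ennreal \<bar>k y\<bar> \<partial>M))"
      by (intro mult_left_mono c(2)[of "\<lambda>y. ennreal \<bar>k y\<bar>"] x) auto
    also have "(\<integral>\<^sup>+y. ennreal \<bar>k y\<bar> \<partial>M) = ennreal (\<integral>y. \<bar>k y\<bar> \<partial>M)"
      using k by (intro nn_integral_eq_integral) auto
    also have "ennreal b * (ennreal c * ennreal (\<integral>y. \<bar>k y\<bar> \<partial>M)) = ennreal (b * c * (\<integral>y. \<bar>k y\<bar> \<partial>M))"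
      using b c(1) by (simp add: ennreal_mult mult.assoc)
    finally have le: "(\<integral>\<^sup>+y. ennreal (norm (f y * k (- y + x))) \<partial>M) \<le> ennreal (b * c * (\<integral>y. \<bar>k y\<bar> \<partial>M))" .
    then have i: "integrable M (\<lambda>y. f y * k (- y + x))"
      by (intro integrableI_bounded) (auto intro: le_less_trans)
    have "ennreal (norm (conv f k x)) \<le> ennreal (b * c * (\<integral>y. \<bar>k y\<bar> \<partial>M))"
      unfolding conv_def using integral_norm_bound_ennreal[OF i] le by (rule order_trans)
    then have "\<bar>conv f k x\<bar> \<le> b * c * (\<integral>y. \<bar>k y\<bar> \<partial>M)"
      using b c(1) by (simp add: ennreal_le_iff)
    with i show ?thesis by blast
  qed
  note bound = this
  show ?thesis
    by (intro exI[of _ c] conjI[OF c(1)] allI impI bound) simp_all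
qed

section \<open>Density of the continuous functions in L1\<close>

lemma continuous_dense_indicator:
  assumes A: "A \<in> sets M" "emeasure M A < \<infinity>" and e: "0 < e"
  obtains g :: "'a \<Rightarrow> real" where "continuous_on UNIV g" "integrable M g"
    "(\<integral>y. \<bar>indicator A y - g y\<bar> \<partial>M) < e"
proof -
  have "emeasure M A < emeasure M A + ennreal (e / 2)"
    using A e by (simp add: ennreal_add_left_cancel_less[of _ 0, simplified] less_top)
  then obtain U where U: "open U" "A \<subseteq> U" "emeasure M U < emeasure M A + ennreal (e / 2)"
    using outer_regular[OF A(1)] by metis
  have Ufin: "emeasure M U < \<infinity>"
    using U(3) A by (simp add: less_top order_less_trans)
  \<comment> \<open>Inner regularity is given for open sets, so \<open>C\<close> approximates
    \<open>U\<close> and need not lie in \<open>A\<close>; the error is then counted once for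
    \<open>A\<close> and once for \<open>C\<close>.\<close>
  have "\<exists>C. compact C \<and> C \<subseteq> U \<and> emeasure M U < emeasure M C + ennreal (e / 2)"
  proof (cases "emeasure M U = 0")
    case True
    then show ?thesis
      using e by (intro exI[of _ "{}"]) auto
  next
    case False
    then have "emeasure M U - ennreal (e / 2) < emeasure M U"
      using e Ufin by (intro ennreal_between) (auto simp: zero_less_iff_neq_zero)
    then obtain C where "compact C" "C \<subseteq> U" "emeasure M U - ennreal (e / 2) < emeasure M C"
      using inner_regular_open[OF U(1)] by (auto simp: less_SUP_iff)
    moreover from this have "emeasure M U < emeasure M C + ennreal (e / 2)"
    proof (cases "ennreal (e / 2) \<le> emeasure M U")
      case False
      have "emeasure M U < ennreal (e / 2)" using False by simp
      also have "\<dots> \<le> emeasure M C + ennreal (e / 2)" by simp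
      finally show ?thesis .
    qed (simp add: minus_less_iff_ennreal)
    ultimately show ?thesis by blast
  qed
  then obtain C where C: "compact C" "C \<subseteq> U" "emeasure M U < emeasure M C + ennreal (e / 2)"
    by metis
  obtain g :: "'a \<Rightarrow> real" where g: "continuous_on UNIV g" "\<And>x. 0 \<le> g x" "\<And>x. g x \<le> 1"
    "\<And>x. x \<in> C \<Longrightarrow> g x = 1" "\<And>x. x \<notin> U \<Longrightarrow> g x = 0"
    using Urysohn_compact_open[OF C(1) U(1) C(2)] by metis
  have sets: "U \<in> sets M" "C \<in> sets M"
    using U C compact_sets by auto
  have fin: "integrable M (indicator S :: 'a \<Rightarrow> real)" if "S \<in> sets M" "S \<subseteq> U" for S
    using that Ufin emeasure_mono[OF that(2) sets(1)]
    by (auto intro!: integrable_real_indicator intro: le_less_trans)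
  have mle: "measure M U < measure M S + e / 2"
    if "S \<in> sets M" "S \<subseteq> U" "emeasure M U < emeasure M S + ennreal (e / 2)" for S
  proof -
    have "emeasure M S < \<infinity>"
      using emeasure_mono[OF that(2) sets(1)] Ufin by (rule le_less_trans)
    then have "ennreal (measure M U) < ennreal (measure M S + e / 2)"
      using that(3) Ufin e by (simp add: emeasure_eq_ennreal_measure less_top)
    then show ?thesis
      by (rule ennreal_less_iff[THEN iffD1, rotated]) simp
  qed
  have gm: "g \<in> borel_measurable M"
    using g(1) by (rule continuous_measurable_M)
  have gi: "integrable M g"
    by (rule Bochner_Integration.integrable_bound[OF fin[OF sets(1) subset_refl] gm])
       (use g in \<open>auto simp: indicator_def\<close>)
  have "(\<integral>y. \<bar>indicator A y - g y\<bar> \<partial>M)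
      \<le> (\<integral>y. (indicator U y - indicator A y) + (indicator U y - indicator C y) \<partial>M)"
  proof (rule integral_mono)
    show "integrable M (\<lambda>y. \<bar>indicator A y - g y\<bar>)"
      using gi fin A U sets by auto
    show "integrable M (\<lambda>y. (indicator U y - indicator A y) + (indicator U y - indicator C y) :: real)"
      using fin A U C sets by auto
    fix y
    show "\<bar>indicator A y - g y\<bar> \<le> (indicator U y - indicator A y) + (indicator U y - indicator C y)"
      using g(2,3)[of y] g(4,5)[of y] U(2) C(2) by (auto simp: indicator_def)
  qed
  also have "\<dots> = (measure M U - measure M A) + (measure M U - measure M C)"
    using fin A U C sets by simp
  also have "\<dots> < e"
    using mle[OF A(1) U(2,3)] mle[OF sets(2) C(2,3)] by simp
  finally show ?thesis
    using that g(1) gi by blast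
qed

lemma continuous_dense:
  assumes k: "integrable M (k :: 'a \<Rightarrow> real)"
  shows "\<forall>e>0. \<exists>g. continuous_on UNIV g \<and> integrable M g \<and> (\<integral>y. \<bar>k y - g y\<bar> \<partial>M) < e"
  using k
proof (induction k rule: integrable_induct)
  case (base A c)
  show ?case
  proof (intro allI impI)
    fix e :: real assume "0 < e"
    then have "0 < e / (\<bar>c\<bar> + 1)"
      by simp
    then obtain g :: "'a \<Rightarrow> real" where g: "continuous_on UNIV g" "integrable M g"
      "(\<integral>y. \<bar>indicator A y - g y\<bar> \<partial>M) < e / (\<bar>c\<bar> + 1)"
      using continuous_dense_indicator[OF base] by metis
    have "\<bar>indicator A y *\<^sub>R c - g y * c\<bar> = \<bar>c\<bar> * \<bar>indicator A y - g y\<bar>" for y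
      by (simp add: abs_mult[symmetric] algebra_simps)
    then have "(\<integral>y. \<bar>indicator A y *\<^sub>R c - g y * c\<bar> \<partial>M) = \<bar>c\<bar> * (\<integral>y. \<bar>indicator A y - g y\<bar> \<partial>M)"
      by simp
    also have "\<dots> \<le> (\<bar>c\<bar> + 1) * (\<integral>y. \<bar>indicator A y - g y\<bar> \<partial>M)"
      by (intro mult_right_mono) auto
    also have "\<dots> < e"
      using g(3) by (simp add: field_simps)
    finally show "\<exists>g. continuous_on UNIV g \<and> integrable M g \<and> (\<integral>y. \<bar>indicator A y *\<^sub>R c - g y\<bar> \<partial>M) < e"
      using g by (intro exI[of _ "\<lambda>y. g y * c"]) (auto intro!: continuous_intros)
  qed
next
  case (add f h)
  show ?case
  proof (intro allI impI)
    fix e :: real assume e: "0 < e"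
    obtain g1 where g1: "continuous_on UNIV g1" "integrable M g1" "(\<integral>y. \<bar>f y - g1 y\<bar> \<partial>M) < e / 2"
      using add.IH(1) e by (meson half_gt_zero)
    obtain g2 where g2: "continuous_on UNIV g2" "integrable M g2" "(\<integral>y. \<bar>h y - g2 y\<bar> \<partial>M) < e / 2"
      using add.IH(2) e by (meson half_gt_zero)
    have "(\<integral>y. \<bar>f y + h y - (g1 y + g2 y)\<bar> \<partial>M) \<le> (\<integral>y. \<bar>f y - g1 y\<bar> + \<bar>h y - g2 y\<bar> \<partial>M)"
      using g1 g2 add.hyps by (intro integral_mono) auto
    also have "\<dots> < e"
      using g1 g2 add.hyps by simp
    finally show "\<exists>g. continuous_on UNIV g \<and> integrable M g \<and> (\<integral>y. \<bar>f y + h y - g y\<bar> \<partial>M) < e"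
      using g1 g2 by (intro exI[of _ "\<lambda>y. g1 y + g2 y"]) (auto intro!: continuous_intros)
  qed
next
  case (lim f s)
  have "(\<lambda>i. \<integral>y. \<bar>f y - s i y\<bar> \<partial>M) \<longlonglongrightarrow> (\<integral>y. 0 \<partial>M)"
  \<comment> \<open>The induction rule supplies \<open>norm (s i y) \<le> 2 * norm (f y)\<close>,
    hence the factor 3.\<close>
  proof (rule integral_dominated_convergence[where w="\<lambda>y. 3 * \<bar>f y\<bar>"])
    show "AE y in M. (\<lambda>i. \<bar>f y - s i y\<bar>) \<longlonglongrightarrow> 0"
    proof (rule AE_I2)
      fix y
      have "(\<lambda>i. \<bar>f y - s i y\<bar>) \<longlonglongrightarrow> \<bar>f y - f y\<bar>"
        using lim.hyps(2)[of y] by (intro tendsto_intros) auto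
      then show "(\<lambda>i. \<bar>f y - s i y\<bar>) \<longlonglongrightarrow> 0" by simp
    qed
    show "AE y in M. norm \<bar>f y - s i y\<bar> \<le> 3 * \<bar>f y\<bar>" for i
    proof (rule AE_I2)
      fix y
      show "norm \<bar>f y - s i y\<bar> \<le> 3 * \<bar>f y\<bar>"
        using lim.hyps(3)[of y i] by auto
    qed
  qed (use lim.hyps in auto)
  then have l: "(\<lambda>i. \<integral>y. \<bar>f y - s i y\<bar> \<partial>M) \<longlonglongrightarrow> 0" by simp
  show ?case
  proof (intro allI impI)
    fix e :: real assume e: "0 < e"
    obtain i where i: "(\<integral>y. \<bar>f y - s i y\<bar> \<partial>M) < e / 2"
      using order_tendstoD(2)[OF l, of "e / 2"] e by (auto simp: eventually_sequentially)
    obtain g where g: "continuous_on UNIV g" "integrable M g" "(\<integral>y. \<bar>s i y - g y\<bar> \<partial>M) < e / 2"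
      using lim.IH[of i] e by (meson half_gt_zero)
    have "(\<integral>y. \<bar>f y - g y\<bar> \<partial>M) \<le> (\<integral>y. \<bar>f y - s i y\<bar> + \<bar>s i y - g y\<bar> \<partial>M)"
      using g lim.hyps by (intro integral_mono) auto
    also have "\<dots> < e"
      using g lim.hyps i by simp
    finally show "\<exists>g. continuous_on UNIV g \<and> integrable M g \<and> (\<integral>y. \<bar>f y - g y\<bar> \<partial>M) < e"
      using g by blast
  qed
qed

section \<open>Approximation by characteristic functions\<close>

text \<open>This is where non-discreteness enters. By left invariance one point of positive measure
  would make all points equally heavy. A compact neighbourhood would then be finite, and in a
  Hausdorff space a point with a finite neighbourhood is isolated.\<close>

lemma emeasure_singleton: "emeasure M {x::'a} = 0"
proof (rule ccontr)
  assume ne: "emeasure M {x} \<noteq> 0"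
  define a where "a = emeasure M {x}"
  have all: "emeasure M {y} = a" for y
  proof -
    have "\<forall>z. \<forall>A\<in>sets M. emeasure M ((\<lambda>y. z + y) ` A) = emeasure M A"
      using haar by (simp add: left_haar_measure_def)
    from bspec[OF spec[OF this, of "y - x"], of "{x}"] show ?thesis
      by (simp add: a_def)
  qed
  have a: "0 < a" "a < \<infinity>"
    using ne compact_finite[of "{x}"] by (auto simp: a_def zero_less_iff_neq_zero)
  obtain U K where UK: "open U" "compact K" "(0::'a) \<in> U" "U \<subseteq> K"
    using compact_neighbourhood by metis
  have "finite K"
  proof (rule ccontr)
    assume "infinite K"
    have "of_nat n * a \<le> emeasure M K" for n
    proof -
      obtain F where F: "F \<subseteq> K" "finite F" "card F = n"
        using \<open>infinite K\<close> infinite_arbitrarily_large by metis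
      have "emeasure M F = (\<Sum>y\<in>F. emeasure M {y})"
        using F by (intro emeasure_eq_sum_singleton) auto
      also have "\<dots> = of_nat n * a"
        using F by (simp add: all)
      finally show ?thesis
        using emeasure_mono[OF F(1) compact_sets[OF UK(2)]] by simp
    qed
    moreover have "\<exists>n. emeasure M K / a < of_nat n"
      using compact_finite[OF UK(2)] a
      by (intro ennreal_Ex_less_of_nat) (auto simp: ennreal_divide_eq_top_iff less_top[symmetric])
    then obtain n where "emeasure M K / a < of_nat n" by blast
    then have "emeasure M K < of_nat n * a"
      using a by (simp add: divide_less_ennreal)
    ultimately show False
      by (meson not_less)
  qed
  then have "closed (K - {0})"
    by (intro finite_imp_closed) auto
  then have "open (U - (K - {0}))"
    using UK(1) by (rule open_Diff[rotated])
  moreover have "U - (K - {0}) = {0}"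
    using UK by auto
  ultimately have o: "open {0::'a}" by simp
  have "open {y}" for y :: 'a
  proof -
    have "(\<lambda>z. - y + z) -` {0} = {y}"
      by (auto simp: add_eq_0_iff)
    moreover have "continuous_on UNIV (\<lambda>z. - y + z)"
      by (intro continuous_intros)
    ultimately show ?thesis
      using o open_vimage by metis
  qed
  then have "open S" for S :: "'a set"
    using open_UN[of S "\<lambda>y. {y}"] by simp
  then have "(euclidean :: 'a topology) = discrete_topology UNIV"
    by (simp add: topology_eq)
  then show False
    using non_discrete by blast
qed

text \<open>Remove the members of the cover from \<open>P\<close> one at a time until the measure
  first falls below \<open>c\<close>; a single removal costs at most \<open>e\<close>.\<close>

lemma subset_of_measure_cover:
  assumes "finite \<U>" "\<And>U. U \<in> \<U> \<Longrightarrow> U \<in> sets M \<and> emeasure M U < ennreal e" "0 \<le> e"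
    and "P \<in> sets M" "emeasure M P < \<infinity>" "P \<subseteq> \<Union>\<U>" "0 \<le> c" "c \<le> measure M P"
  shows "\<exists>B\<in>sets M. B \<subseteq> P \<and> measure M B \<le> c \<and> c - e \<le> measure M B"
  using assms
proof (induction \<U> arbitrary: P rule: finite_induct)
  case empty
  then show ?case by (intro bexI[of _ "{}"]) auto
next
  case (insert U \<U>)
  have U: "U \<in> sets M" "emeasure M U < ennreal e"
    using insert.prems(1) by auto
  have P': "P - U \<in> sets M" "emeasure M (P - U) < \<infinity>"
    using insert.prems U emeasure_mono[of "P - U" P M] by (auto intro: le_less_trans)
  show ?case
  proof (cases "c \<le> measure M (P - U)")
    case True
    then have "\<exists>B\<in>sets M. B \<subseteq> P - U \<and> measure M B \<le> c \<and> c - e \<le> measure M B"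
      using insert.prems P' by (intro insert.IH) auto
    then show ?thesis by blast
  next
    case False
    have fm: "P \<in> fmeasurable M" "U \<in> fmeasurable M" "P - U \<in> fmeasurable M"
      using insert.prems P' U order_less_trans[OF U(2) ennreal_less_top]
      by (auto intro!: fmeasurableI)
    have "measure M P \<le> measure M ((P - U) \<union> U)"
      using fm by (intro measure_mono_fmeasurable) auto
    also have "\<dots> \<le> measure M (P - U) + measure M U"
      using fm by (intro measure_Un_le) auto
    also have "measure M U \<le> e"
      using U(2) \<open>0 \<le> e\<close> unfolding measure_def by (intro enn2real_leI) auto
    finally show ?thesis
      using False P' insert.prems by (intro bexI[of _ "P - U"]) auto
  qed
qed

text \<open>Points are null, so by outer regularity each has an open neighbourhood of measure less
  than \<open>e\<close>; compactness leaves finitely many of these as a cover.\<close>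

lemma subset_of_measure:
  assumes K: "compact K" and P: "P \<in> sets M" "P \<subseteq> K" and c: "0 \<le> c" "c \<le> measure M P" and e: "0 < e"
  obtains B where "B \<in> sets M" "B \<subseteq> P" "measure M B \<le> c" "c - e \<le> measure M B"
proof -
  have "\<exists>U. open U \<and> x \<in> U \<and> emeasure M U < ennreal e" for x
  proof -
    obtain U where "open U" "{x} \<subseteq> U" "emeasure M U < ennreal e"
      using outer_regular[of "{x}" "ennreal e"] e by (metis closed_singleton borel_closed sets_M
        emeasure_singleton ennreal_0 ennreal_less_iff order_refl)
    then show ?thesis by blast
  qed
  then obtain U where U: "\<And>x. open (U x) \<and> x \<in> U x \<and> emeasure M (U x) < ennreal e"
    by metis
  obtain D where D: "D \<subseteq> K" "finite D" "K \<subseteq> (\<Union>x\<in>D. U x)"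
    by (rule compactE_image[OF K, of K U]) (use U in auto)
  have "emeasure M P < \<infinity>"
    using emeasure_mono[OF P(2) compact_sets[OF K]] compact_finite[OF K] by (rule le_less_trans)
  then have "\<exists>B\<in>sets M. B \<subseteq> P \<and> measure M B \<le> c \<and> c - e \<le> measure M B"
    using D P c e U by (intro subset_of_measure_cover[of "U ` D"]) auto
  then show ?thesis
    using that by blast
qed

text \<open>Equicontinuity makes every member of the family almost constant on the pieces of a fine
  partition, and on each piece the set can be chosen to carry nearly the mass of \<open>f\<close>.\<close>

lemma set_approximation_cover:
  assumes "finite \<V>" and "\<And>V. V \<in> \<V> \<Longrightarrow> open V"
    and osc: "\<And>V h y z. V \<in> \<V> \<Longrightarrow> h \<in> H \<Longrightarrow> y \<in> V \<Longrightarrow> z \<in> V \<Longrightarrow> \<bar>h y - h z\<bar> \<le> \<eta>"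
    and K: "compact K" and S: "\<And>h y. h \<in> H \<Longrightarrow> y \<in> K \<Longrightarrow> \<bar>h y\<bar> \<le> S" "0 < S"
    and H: "\<And>h. h \<in> H \<Longrightarrow> h \<in> borel_measurable M"
    and f: "f \<in> borel_measurable M" "\<And>y. 0 \<le> f y" "\<And>y. f y \<le> 1"
    and P: "P \<in> sets M" "P \<subseteq> K" "P \<subseteq> \<Union>\<V>" and e: "0 < e" and \<eta>: "0 \<le> \<eta>"
  shows "\<exists>E\<in>sets M. E \<subseteq> P \<and> measure M E \<le> (\<integral>y. indicator P y * f y \<partial>M) \<and>
     (\<forall>h\<in>H. \<bar>\<integral>y. (indicator P y * f y - indicator E y) * h y \<partial>M\<bar> \<le> \<eta> * measure M P + e)"
  using assms(1,2,3) P e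
proof (induction \<V> arbitrary: P e rule: finite_induct)
  case empty
  then show ?case by (intro bexI[of _ "{}"]) auto
next
  case (insert V \<V>)
  note [measurable] = f(1) H
  have fin: "integrable M (\<lambda>y. indicator A y * u y :: real)"
    if A: "A \<in> sets M" "A \<subseteq> K" and u: "u \<in> borel_measurable M" "\<And>y. y \<in> K \<Longrightarrow> \<bar>u y\<bar> \<le> c" for A u c
  proof (rule Bochner_Integration.integrable_bound)
    show "integrable M (\<lambda>y. c * indicator K y)"
      using compact_sets[OF K] compact_finite[OF K] by (intro integrable_mult_right) simp
    show "(\<lambda>y. indicator A y * u y) \<in> borel_measurable M"
      using A u by measurable
    show "AE y in M. norm (indicator A y * u y) \<le> norm (c * indicator K y)"
      using A(2) u(2) by (intro AE_I2) (force simp: indicator_def)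
  qed
  have fe: "emeasure M A < \<infinity>" if "A \<subseteq> K" for A
    using emeasure_mono[OF that compact_sets[OF K]] compact_finite[OF K] by (rule le_less_trans)
  have V: "V \<in> sets M"
    using insert.prems(1) by simp
  \<comment> \<open>One member of the cover is split off. \<open>Q\<close> and \<open>R\<close> are
    disjoint, so the errors with factor \<open>\<eta>\<close> add up to
    \<open>\<eta> * measure M P\<close>, while \<open>e\<close> is shared in halves.\<close>
  define Q where "Q = P \<inter> V"
  define R where "R = P - V"
  have Q: "Q \<in> sets M" "Q \<subseteq> K" "Q \<subseteq> V" and R: "R \<in> sets M" "R \<subseteq> K" "R \<subseteq> \<Union>\<V>"
    using insert.prems V by (auto simp: Q_def R_def)
  have QR: "indicator P y = indicator Q y + (indicator R y :: real)" for y
    by (auto simp: Q_def R_def indicator_def)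
  have "\<exists>E\<in>sets M. E \<subseteq> R \<and> measure M E \<le> (\<integral>y. indicator R y * f y \<partial>M) \<and>
     (\<forall>h\<in>H. \<bar>\<integral>y. (indicator R y * f y - indicator E y) * h y \<partial>M\<bar> \<le> \<eta> * measure M R + e / 2)"
    using R insert.prems(6)
  proof (intro insert.IH)
    show "open W" if "W \<in> \<V>" for W
      using that insert.prems(1) by simp
    show "\<bar>h y - h z\<bar> \<le> \<eta>" if "W \<in> \<V>" "h \<in> H" "y \<in> W" "z \<in> W" for W h y z
      using that insert.prems(2)[of W h y z] by simp
  qed auto
  then obtain E1 where E1': "E1 \<in> sets M"
    "E1 \<subseteq> R \<and> measure M E1 \<le> (\<integral>y. indicator R y * f y \<partial>M) \<and>
     (\<forall>h\<in>H. \<bar>\<integral>y. (indicator R y * f y - indicator E1 y) * h y \<partial>M\<bar> \<le> \<eta> * measure M R + e / 2)"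
    by (rule bexE)
  note E1 = E1'(1) E1'(2)[THEN conjunct1] E1'(2)[THEN conjunct2, THEN conjunct1]
    E1'(2)[THEN conjunct2, THEN conjunct2, rule_format]
  define I where "I = (\<integral>y. indicator Q y * f y \<partial>M)"
  have fQ: "integrable M (\<lambda>y. indicator Q y * f y)"
    using f by (intro fin[OF Q(1,2), where c=1]) auto
  have iA: "integrable M (indicator A :: 'a \<Rightarrow> real)" if "A \<in> sets M" "A \<subseteq> K" for A
    using fin[OF that, of "\<lambda>_. 1" 1] by simp
  have "I \<le> (\<integral>y. indicator Q y \<partial>M)"
    unfolding I_def using fQ f by (intro integral_mono iA Q) (auto simp: indicator_def)
  then have I: "0 \<le> I" "I \<le> measure M Q"
    using f Q unfolding I_def by (auto intro!: integral_nonneg_AE)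
  \<comment> \<open>\<open>E2\<close> carries the mass of \<open>f\<close> on \<open>Q\<close> up to
    a deficit \<open>e / (2 * S)\<close>, which a value of \<open>h\<close>, at most
    \<open>S\<close> in modulus, turns into \<open>e / 2\<close>. It never carries more than this
    mass, and so the bound on \<open>measure M E\<close> has no error term.\<close>
  obtain E2 where E2: "E2 \<in> sets M" "E2 \<subseteq> Q" "measure M E2 \<le> I" "I - e / (2 * S) \<le> measure M E2"
    using subset_of_measure[OF K Q(1,2) I, of "e / (2 * S)"] insert.prems S by auto
  have EK: "E1 \<subseteq> K" "E2 \<subseteq> K"
    using E1 E2 Q R by auto
  have dis: "E1 \<inter> E2 = {}"
    using E1(2) E2(2) by (auto simp: Q_def R_def)
  have ind: "indicator (E1 \<union> E2) y = indicator E1 y + (indicator E2 y :: real)" for y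
    using dis by (auto simp: indicator_def)
  have fR: "integrable M (\<lambda>y. indicator R y * f y)"
    using f by (intro fin[OF R(1,2), where c=1]) auto
  show ?case
  proof (intro bexI[of _ "E1 \<union> E2"] conjI ballI)
    show "E1 \<union> E2 \<subseteq> P"
      using E1(2) E2(2) by (auto simp: Q_def R_def)
    have "measure M (E1 \<union> E2) \<le> measure M E1 + measure M E2"
      using E1 E2 by (intro measure_Un_le) auto
    also have "\<dots> \<le> (\<integral>y. indicator R y * f y \<partial>M) + I"
      using E1 E2 by simp
    also have "\<dots> = (\<integral>y. indicator P y * f y \<partial>M)"
      unfolding I_def QR distrib_right using fQ fR by simp
    finally show "measure M (E1 \<union> E2) \<le> (\<integral>y. indicator P y * f y \<partial>M)" .
  next
    fix h assume h: "h \<in> H"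
    note hm [measurable] = H[OF h]
    have d1: "integrable M (\<lambda>y. (indicator R y * f y - indicator E1 y) * h y)"
    proof -
      have "integrable M (\<lambda>y. indicator K y * ((indicator R y * f y - indicator E1 y) * h y))"
      proof (rule fin[OF compact_sets[OF K] subset_refl, where c=S])
        fix y assume "y \<in> K"
        have "\<bar>indicator R y * f y - indicator E1 y\<bar> \<le> 1"
          using f(2,3)[of y] by (auto simp: indicator_def)
        then have "\<bar>(indicator R y * f y - indicator E1 y) * h y\<bar> \<le> 1 * S"
          unfolding abs_mult using S(1)[OF h \<open>y \<in> K\<close>] by (intro mult_mono) auto
        then show "\<bar>(indicator R y * f y - indicator E1 y) * h y\<bar> \<le> S" by simp
      qed (use R E1 in measurable)
      also have "(\<lambda>y. indicator K y * ((indicator R y * f y - indicator E1 y) * h y))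
          = (\<lambda>y. (indicator R y * f y - indicator E1 y) * h y)"
        using EK R by (auto simp: indicator_def fun_eq_iff)
      finally show ?thesis .
    qed
    have d2: "integrable M (\<lambda>y. (indicator Q y * f y - indicator E2 y) * h y)"
    proof -
      have "integrable M (\<lambda>y. indicator K y * ((indicator Q y * f y - indicator E2 y) * h y))"
      proof (rule fin[OF compact_sets[OF K] subset_refl, where c=S])
        fix y assume "y \<in> K"
        have "\<bar>indicator Q y * f y - indicator E2 y\<bar> \<le> 1"
          using f(2,3)[of y] by (auto simp: indicator_def)
        then have "\<bar>(indicator Q y * f y - indicator E2 y) * h y\<bar> \<le> 1 * S"
          unfolding abs_mult using S(1)[OF h \<open>y \<in> K\<close>] by (intro mult_mono) auto
        then show "\<bar>(indicator Q y * f y - indicator E2 y) * h y\<bar> \<le> S" by simp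
      qed (use Q E2 in measurable)
      also have "(\<lambda>y. indicator K y * ((indicator Q y * f y - indicator E2 y) * h y))
          = (\<lambda>y. (indicator Q y * f y - indicator E2 y) * h y)"
        using EK Q by (auto simp: indicator_def fun_eq_iff)
      finally show ?thesis .
    qed
    have main: "\<bar>\<integral>y. (indicator Q y * f y - indicator E2 y) * h y \<partial>M\<bar> \<le> \<eta> * measure M Q + e / 2"
    proof (cases "Q = {}")
      case True
      with E2 have "E2 = {}" by auto
      with True show ?thesis using insert.prems by simp
    next
      case False
      \<comment> \<open>On \<open>Q\<close> the function \<open>h\<close> equals \<open>h z\<close>
        up to \<open>\<eta>\<close>. The constant sees only the difference of the masses; the rest
        contributes at most \<open>\<eta>\<close> times the measure of \<open>Q\<close>.\<close>
      then obtain z where z: "z \<in> Q" by auto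
      have hz: "\<bar>h z\<bar> \<le> S"
        using z Q(2) by (intro S h) auto
      have "(\<integral>y. (indicator Q y * f y - indicator E2 y) * h y \<partial>M)
          = (\<integral>y. (indicator Q y * f y - indicator E2 y) * h z
              + (indicator Q y * f y - indicator E2 y) * (h y - h z) \<partial>M)"
        by (intro Bochner_Integration.integral_cong) (auto simp: algebra_simps)
      also have "\<dots> = (\<integral>y. (indicator Q y * f y - indicator E2 y) * h z \<partial>M)
          + (\<integral>y. (indicator Q y * f y - indicator E2 y) * (h y - h z) \<partial>M)"
        using d2 fQ iA[OF E2(1) EK(2)]
        by (intro Bochner_Integration.integral_add) (auto simp: right_diff_distrib)
      also have "(\<integral>y. (indicator Q y * f y - indicator E2 y) * h z \<partial>M) = (I - measure M E2) * h z"
        unfolding I_def using fQ iA[OF E2(1) EK(2)] by simp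
      finally have eq: "(\<integral>y. (indicator Q y * f y - indicator E2 y) * h y \<partial>M)
          = (I - measure M E2) * h z
            + (\<integral>y. (indicator Q y * f y - indicator E2 y) * (h y - h z) \<partial>M)" .
      have "\<bar>(I - measure M E2) * h z\<bar> \<le> e / (2 * S) * S"
        unfolding abs_mult using E2 hz by (intro mult_mono) auto
      then have b1: "\<bar>(I - measure M E2) * h z\<bar> \<le> e / 2"
        using S(2) by simp
      have "\<bar>\<integral>y. (indicator Q y * f y - indicator E2 y) * (h y - h z) \<partial>M\<bar>
          \<le> (\<integral>y. \<eta> * indicator Q y \<partial>M)"
      proof (rule order_trans[OF integral_abs_bound integral_mono])
        have "integrable M (\<lambda>y. (indicator Q y * f y - indicator E2 y) * (h y - h z))"
          using d2 fQ iA[OF E2(1) EK(2)] by (auto simp: right_diff_distrib)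
        then show "integrable M (\<lambda>y. \<bar>(indicator Q y * f y - indicator E2 y) * (h y - h z)\<bar>)"
          by (rule integrable_abs)
        show "integrable M (\<lambda>y. \<eta> * indicator Q y)"
          using iA[OF Q(1,2)] by simp
        fix y
        show "\<bar>(indicator Q y * f y - indicator E2 y) * (h y - h z)\<bar> \<le> \<eta> * indicator Q y"
        proof (cases "y \<in> Q")
          case True
          have "\<bar>indicator Q y * f y - indicator E2 y\<bar> \<le> 1"
            using f(2,3)[of y] by (auto simp: indicator_def)
          moreover have "\<bar>h y - h z\<bar> \<le> \<eta>"
            using insert.prems(2)[of V h y z] h True z Q(3) by auto
          ultimately have "\<bar>(indicator Q y * f y - indicator E2 y) * (h y - h z)\<bar> \<le> 1 * \<eta>"
            unfolding abs_mult by (intro mult_mono) auto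
          then show ?thesis using True by simp
        next
          case False
          then show ?thesis using E2(2) by (auto simp: indicator_def)
        qed
      qed
      also have "\<dots> = \<eta> * measure M Q"
        by simp
      finally show ?thesis
        unfolding eq using b1 by linarith
    qed
    have "(\<integral>y. (indicator P y * f y - indicator (E1 \<union> E2) y) * h y \<partial>M)
        = (\<integral>y. (indicator R y * f y - indicator E1 y) * h y
              + (indicator Q y * f y - indicator E2 y) * h y \<partial>M)"
      unfolding QR ind by (intro Bochner_Integration.integral_cong) (auto simp: algebra_simps)
    also have "\<dots> = (\<integral>y. (indicator R y * f y - indicator E1 y) * h y \<partial>M)
        + (\<integral>y. (indicator Q y * f y - indicator E2 y) * h y \<partial>M)"
      using d1 d2 by (rule Bochner_Integration.integral_add)
    finally have "\<bar>\<integral>y. (indicator P y * f y - indicator (E1 \<union> E2) y) * h y \<partial>M\<bar>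
        \<le> \<eta> * (measure M R + measure M Q) + e"
      using main E1(4)[OF h] by (simp add: distrib_left)
    also have "measure M R + measure M Q = measure M (R \<union> Q)"
      using Q R fe by (intro measure_Union[symmetric]) (auto simp: Q_def R_def less_top[symmetric])
    also have "R \<union> Q = P"
      by (auto simp: Q_def R_def)
    finally show "\<bar>\<integral>y. (indicator P y * f y - indicator (E1 \<union> E2) y) * h y \<partial>M\<bar> \<le> \<eta> * measure M P + e" .
  qed (use E1 E2 in auto)
qed

lemma conv_diff_kernel:
  assumes "integrable M (\<lambda>y. f y * k (- y + x))" "integrable M (\<lambda>y. f y * g (- y + x))"
  shows "conv f (\<lambda>y. k y - g y) x = conv f k x - conv f g x"
  using assms by (simp add: conv_def right_diff_distrib)

text \<open>The family \<open>H\<close> consists of the functions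
  \<open>\<lambda>y. g j (- y + x)\<close> for all \<open>x\<close> in \<open>L\<close>, with
  continuous \<open>g j\<close> close to \<open>k j\<close> in L1. It may be infinite, but
  compactness of \<open>L\<close> makes it equicontinuous. The error \<open>\<delta>\<close> is
  spent as \<open>\<delta> / 4\<close> for each of the two changes of kernel and
  \<open>\<delta> / 2\<close> for the passage from \<open>f\<close> to \<open>E\<close>.\<close>

lemma set_approximation_conv:
  fixes k :: "nat \<Rightarrow> 'a \<Rightarrow> real"
  assumes K: "compact K" and L: "compact L" and J: "finite J"
    and f: "f \<in> borel_measurable M" "\<And>y. 0 \<le> f y" "\<And>y. f y \<le> indicator K y"
    and k: "\<And>j. j \<in> J \<Longrightarrow> integrable M (k j)" and \<delta>: "0 < \<delta>"
  shows "\<exists>E\<in>sets M. E \<subseteq> K \<and> measure M E \<le> (\<integral>y. f y \<partial>M) \<and>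
    (\<forall>j\<in>J. \<forall>x\<in>L. \<bar>conv f (k j) x - conv (indicator E) (k j) x\<bar> \<le> \<delta>)"
proof -
  obtain c :: real where c': "0 \<le> c \<and> (\<forall>f b k x. f \<in> borel_measurable M \<longrightarrow> (\<forall>y. \<bar>f y\<bar> \<le> b * indicator K y) \<longrightarrow> 0 \<le> b \<longrightarrow>
       integrable M k \<longrightarrow> x \<in> L \<longrightarrow>
       integrable M (\<lambda>y. f y * k (- y + x)) \<and> \<bar>conv f k x\<bar> \<le> b * c * (\<integral>y. \<bar>k y\<bar> \<partial>M))"
    using conv_bound[OF K L] by (rule exE)
  note c = conjunct1[OF c'] conjunct2[OF c', rule_format]
  have f1: "f y \<le> 1" for y
    using f(3)[of y] by (cases "y \<in> K") auto
  have fK: "indicator K y * f y = f y" for y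
    using f(2,3)[of y] by (cases "y \<in> K") auto
  define d where "d = \<delta> / (4 * (c + 1))"
  have d: "0 < d" "c * d \<le> \<delta> / 4"
    using c(1) \<delta> by (auto simp: d_def field_simps)
  have "\<forall>j\<in>J. \<exists>g. continuous_on UNIV g \<and> integrable M g \<and> (\<integral>y. \<bar>k j y - g y\<bar> \<partial>M) < d"
    using continuous_dense[OF k] d(1) by blast
  then obtain g where g: "\<And>j. j \<in> J \<Longrightarrow> continuous_on UNIV (g j)"
    "\<And>j. j \<in> J \<Longrightarrow> integrable M (g j)" "\<And>j. j \<in> J \<Longrightarrow> (\<integral>y. \<bar>k j y - g j y\<bar> \<partial>M) < d"
    by (auto dest!: bchoice)
  have gc: "continuous_on UNIV (\<lambda>z::'a \<times> 'a. g j (- fst z + snd z))" if "j \<in> J" for j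
    by (rule continuous_on_compose2[OF g(1)[OF that]]) (auto intro!: continuous_intros)
  define H where "H = {\<lambda>y. g j (- y + x) | j x. j \<in> J \<and> x \<in> L}"
  have "\<exists>s. \<forall>y\<in>K. \<forall>x\<in>L. \<bar>g j (- y + x)\<bar> \<le> s" if "j \<in> J" for j
  proof -
    have "compact ((\<lambda>z. g j (- fst z + snd z)) ` (K \<times> L))"
      by (intro compact_continuous_image compact_Times K L continuous_on_subset[OF gc[OF that]]) auto
    then have "bounded ((\<lambda>z. g j (- fst z + snd z)) ` (K \<times> L))"
      by (rule compact_imp_bounded)
    then show ?thesis
      by (auto simp: bounded_iff)
  qed
  then have "\<forall>j\<in>J. \<exists>s. \<forall>y\<in>K. \<forall>x\<in>L. \<bar>g j (- y + x)\<bar> \<le> s" by blast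
  then obtain s where s: "\<forall>j\<in>J. \<forall>y\<in>K. \<forall>x\<in>L. \<bar>g j (- y + x)\<bar> \<le> s j"
    by (rule bchoice[THEN exE])
  define S where "S = 1 + (\<Sum>j\<in>J. \<bar>s j\<bar>)"
  have S: "0 < S"
    unfolding S_def by (intro add_pos_nonneg sum_nonneg) auto
  have Sb: "\<bar>h y\<bar> \<le> S" if h: "h \<in> H" and y: "y \<in> K" for h y
  proof -
    obtain j x where jx: "h = (\<lambda>y. g j (- y + x))" "j \<in> J" "x \<in> L"
      using h unfolding H_def by blast
    have "\<bar>h y\<bar> \<le> \<bar>s j\<bar>"
      using s jx y by fastforce
    also have "\<dots> \<le> (\<Sum>j\<in>J. \<bar>s j\<bar>)"
      using J jx by (intro member_le_sum) auto
    finally show ?thesis unfolding S_def by simp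
  qed
  \<comment> \<open>Together with \<open>e = \<delta> / 4\<close> this gives the share
    \<open>\<delta> / 2\<close>; the summand 1 admits a null set \<open>K\<close>.\<close>
  define \<eta> where "\<eta> = \<delta> / (4 * (measure M K + 1))"
  have m0: "0 \<le> measure M K" by simp
  have \<eta>: "0 < \<eta>" "\<eta> * measure M K \<le> \<delta> / 4"
    using \<delta> m0 by (auto simp: \<eta>_def field_simps add_pos_nonneg)
  \<comment> \<open>The tube lemma yields a neighbourhood of \<open>y0\<close> that works for all
    \<open>x\<close> in \<open>L\<close>. The bound \<open>\<eta> / 2\<close> leaves
    \<open>\<eta>\<close> for two arbitrary points of it.\<close>
  have "\<exists>V. open V \<and> y0 \<in> V \<and> (\<forall>j\<in>J. \<forall>y\<in>V. \<forall>x\<in>L. \<bar>g j (- y + x) - g j (- y0 + x)\<bar> < \<eta> / 2)" for y0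
  proof -
    have "\<exists>V. y0 \<in> V \<and> open V \<and> V \<times> L \<subseteq> {z. \<bar>g j (- fst z + snd z) - g j (- y0 + snd z)\<bar> < \<eta> / 2}"
      if j: "j \<in> J" for j
    proof (rule Elementary_Topology.tube_lemma[OF L])
      have "continuous_on UNIV (\<lambda>z::'a \<times> 'a. g j (- y0 + snd z))"
        by (rule continuous_on_compose2[OF g(1)[OF j]]) (auto intro!: continuous_intros)
      then show "open {z. \<bar>g j (- fst z + snd z) - g j (- y0 + snd z)\<bar> < \<eta> / 2}"
        by (intro open_Collect_less continuous_intros gc j)
    qed (use \<eta> in auto)
    then have "\<forall>j\<in>J. \<exists>V. y0 \<in> V \<and> open V \<and> V \<times> L \<subseteq> {z. \<bar>g j (- fst z + snd z) - g j (- y0 + snd z)\<bar> < \<eta> / 2}"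
      by blast
    then obtain V where V: "\<forall>j\<in>J. y0 \<in> V j \<and> open (V j)
        \<and> V j \<times> L \<subseteq> {z. \<bar>g j (- fst z + snd z) - g j (- y0 + snd z)\<bar> < \<eta> / 2}"
      by (rule bchoice[THEN exE])
    show ?thesis
    proof (intro exI[of _ "\<Inter>j\<in>J. V j"] conjI ballI)
      show "open (\<Inter>j\<in>J. V j)" using V J by (intro open_INT) auto
      show "y0 \<in> (\<Inter>j\<in>J. V j)" using V by auto
      fix j y x assume "j \<in> J" "y \<in> (\<Inter>j\<in>J. V j)" "x \<in> L"
      then have "(y, x) \<in> V j \<times> L" by auto
      then show "\<bar>g j (- y + x) - g j (- y0 + x)\<bar> < \<eta> / 2"
        using V \<open>j \<in> J\<close> by fastforce
    qed
  qed
  then obtain V where V: "\<And>y0. open (V y0)" "\<And>y0. y0 \<in> V y0"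
    "\<And>y0 j y x. j \<in> J \<Longrightarrow> y \<in> V y0 \<Longrightarrow> x \<in> L \<Longrightarrow> \<bar>g j (- y + x) - g j (- y0 + x)\<bar> < \<eta> / 2"
    by metis
  obtain D where D: "D \<subseteq> K" "finite D" "K \<subseteq> (\<Union>y\<in>D. V y)"
    by (rule compactE_image[OF K, of K V]) (use V in auto)
  have ex: "\<exists>E\<in>sets M. E \<subseteq> K \<and> measure M E \<le> (\<integral>y. indicator K y * f y \<partial>M) \<and>
     (\<forall>h\<in>H. \<bar>\<integral>y. (indicator K y * f y - indicator E y) * h y \<partial>M\<bar> \<le> \<eta> * measure M K + \<delta> / 4)"
  proof (rule set_approximation_cover[of "V ` D" H \<eta> K S])
    show "\<bar>h y - h z\<bar> \<le> \<eta>" if W: "W \<in> V ` D" and h: "h \<in> H" and yz: "y \<in> W" "z \<in> W" for W h y z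
    proof -
      obtain y0 where y0: "W = V y0" using W by blast
      obtain j x where jx: "h = (\<lambda>y. g j (- y + x))" "j \<in> J" "x \<in> L"
        using h unfolding H_def by blast
      show ?thesis
        using V(3)[OF jx(2) _ jx(3), of y y0] V(3)[OF jx(2) _ jx(3), of z y0] yz
        unfolding jx(1) y0 by linarith
    qed
    show "h \<in> borel_measurable M" if hH: "h \<in> H" for h
    proof -
      obtain j x where jx: "h = (\<lambda>y. g j (- y + x))" "j \<in> J" "x \<in> L"
        using hH unfolding H_def by blast
      show ?thesis unfolding jx(1)
        by (intro continuous_measurable_M continuous_on_compose2[OF g(1)[OF jx(2)]]
              continuous_intros) auto
    qed
  qed (use D V K Sb S f f1 \<eta> \<delta> compact_sets[OF K] in auto)
  then obtain E where E': "E \<in> sets M" "E \<subseteq> K \<and> measure M E \<le> (\<integral>y. indicator K y * f y \<partial>M) \<and>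
     (\<forall>h\<in>H. \<bar>\<integral>y. (indicator K y * f y - indicator E y) * h y \<partial>M\<bar> \<le> \<eta> * measure M K + \<delta> / 4)"
    by (rule bexE)
  have E: "E \<subseteq> K" "measure M E \<le> (\<integral>y. f y \<partial>M)"
    "\<And>h. h \<in> H \<Longrightarrow> \<bar>\<integral>y. (f y - indicator E y) * h y \<partial>M\<bar> \<le> \<delta> / 2"
    using E' \<eta>(2) unfolding fK by fastforce+
  have Em: "(indicator E :: 'a \<Rightarrow> real) \<in> borel_measurable M"
    using E'(1) by simp
  have fb: "\<bar>f y\<bar> \<le> 1 * indicator K y" "\<bar>indicator E y\<bar> \<le> 1 * (indicator K y :: real)" for y
    using f(2,3)[of y] E(1) by (auto simp: indicator_def)
  show ?thesis
  proof (intro bexI[OF _ E'(1)] conjI E(1,2) ballI)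
    fix j x assume j: "j \<in> J" and x: "x \<in> L"
    note cf = c(2)[OF f(1) fb(1) zero_le_one _ x]
    note cE = c(2)[OF Em fb(2) zero_le_one _ x]
    have kg: "integrable M (\<lambda>y. k j y - g j y)"
      using k[OF j] g(2)[OF j] by simp
    have cd: "1 * c * (\<integral>y. \<bar>k j y - g j y\<bar> \<partial>M) \<le> \<delta> / 4"
      using mult_left_mono[OF less_imp_le[OF g(3)[OF j]] c(1)] d(2) by simp
    have 1: "\<bar>conv f (k j) x - conv f (g j) x\<bar> \<le> \<delta> / 4"
      using cf[OF kg] cd conv_diff_kernel[of f "k j" x "g j"] cf[OF k[OF j]] cf[OF g(2)[OF j]] by linarith
    have 2: "\<bar>conv (indicator E) (k j) x - conv (indicator E) (g j) x\<bar> \<le> \<delta> / 4"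
      using cE[OF kg] cd conv_diff_kernel[of "indicator E" "k j" x "g j"] cE[OF k[OF j]] cE[OF g(2)[OF j]]
      by linarith
    have "(\<lambda>y. g j (- y + x)) \<in> H"
      using j x unfolding H_def by blast
    then have "\<bar>\<integral>y. (f y - indicator E y) * g j (- y + x) \<partial>M\<bar> \<le> \<delta> / 2"
      by (rule E(3))
    then have 3: "\<bar>conv f (g j) x - conv (indicator E) (g j) x\<bar> \<le> \<delta> / 2"
      using cf[OF g(2)[OF j]] cE[OF g(2)[OF j]] by (simp add: conv_def left_diff_distrib)
    show "\<bar>conv f (k j) x - conv (indicator E) (k j) x\<bar> \<le> \<delta>"
      using 1 2 3 by linarith
  qed
qed

section \<open>Convolutions of integrable functions\<close>

lemma continuous_approximation:
  assumes k: "integrable M (k :: 'a \<Rightarrow> real)"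
  obtains g :: "nat \<Rightarrow> 'a \<Rightarrow> real" where "\<And>n. continuous_on UNIV (g n)" "\<And>n. integrable M (g n)"
    "(\<lambda>n. \<integral>y. \<bar>k y - g n y\<bar> \<partial>M) \<longlonglongrightarrow> 0"
proof -
  have "\<exists>g. continuous_on UNIV g \<and> integrable M g \<and> (\<integral>y. \<bar>k y - g y\<bar> \<partial>M) < 1 / Suc n" for n
    using continuous_dense[OF k] by simp
  then obtain g where g: "\<And>n. continuous_on UNIV (g n)" "\<And>n. integrable M (g n)"
    "\<And>n. (\<integral>y. \<bar>k y - g n y\<bar> \<partial>M) < 1 / Suc n"
    by metis
  have "(\<lambda>n. \<integral>y. \<bar>k y - g n y\<bar> \<partial>M) \<longlonglongrightarrow> 0"
  proof (rule tendsto_sandwich[OF _ _ tendsto_const])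
    show "(\<lambda>n. 1 / real (Suc n)) \<longlonglongrightarrow> 0"
      using LIMSEQ_inverse_real_of_nat by (simp add: inverse_eq_divide)
    show "eventually (\<lambda>n. (\<integral>y. \<bar>k y - g n y\<bar> \<partial>M) \<le> 1 / real (Suc n)) sequentially"
      by (intro always_eventually allI less_imp_le g(3))
  qed simp
  then show ?thesis
    using that g by blast
qed

definition bounded_cs :: "('a \<Rightarrow> real) \<Rightarrow> bool" where
  "bounded_cs f \<longleftrightarrow> f \<in> borel_measurable M \<and> (\<exists>K b. compact K \<and> 0 \<le> b \<and> (\<forall>y. \<bar>f y\<bar> \<le> b * indicator K y))"

lemma bounded_cs_measurable: "bounded_cs f \<Longrightarrow> f \<in> borel_measurable M"
  by (simp add: bounded_cs_def)

lemma bounded_cs_mono: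
  assumes "bounded_cs f" "g \<in> borel_measurable M" "\<And>y. \<bar>g y\<bar> \<le> \<bar>f y\<bar>"
  shows "bounded_cs g"
proof -
  obtain K b where "compact K" "0 \<le> b" "\<And>y. \<bar>f y\<bar> \<le> b * indicator K y"
    using assms(1) unfolding bounded_cs_def by auto
  then show ?thesis
    unfolding bounded_cs_def using assms(2,3) order_trans by blast
qed

lemma bounded_cs_integrable:
  assumes "bounded_cs f"
  shows "integrable M f"
proof -
  obtain K b where K: "compact K" "0 \<le> b" "\<And>y. \<bar>f y\<bar> \<le> b * indicator K y"
    using assms(1) unfolding bounded_cs_def by auto
  have "integrable M (\<lambda>y. b * indicator K y)"
    using compact_sets[OF K(1)] compact_finite[OF K(1)] by (intro integrable_mult_right) simp
  then show ?thesis
    by (rule Bochner_Integration.integrable_bound)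
       (use K assms in \<open>auto simp: bounded_cs_def intro!: AE_I2 order_trans[OF K(3)]\<close>)
qed

lemma bounded_cs_conv_integrable:
  assumes "bounded_cs f" "integrable M k"
  shows "integrable M (\<lambda>y. f y * k (- y + x))"
proof -
  obtain K b where K: "compact K" "0 \<le> b" "\<And>y. \<bar>f y\<bar> \<le> b * indicator K y"
    using assms(1) unfolding bounded_cs_def by auto
  show ?thesis
    using conv_bound[OF K(1) compact_sing, of x] K assms by (auto simp: bounded_cs_def)
qed

lemma conv_tendsto_kernel:
  assumes f: "bounded_cs f" and k: "integrable M k" and g: "\<And>n. integrable M (g n)"
    and lim: "(\<lambda>n. \<integral>y. \<bar>k y - g n y\<bar> \<partial>M) \<longlonglongrightarrow> 0"
  shows "(\<lambda>n. conv f (g n) x) \<longlonglongrightarrow> conv f k x"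
proof -
  obtain K b where K: "compact K" "0 \<le> b" "\<And>y. \<bar>f y\<bar> \<le> b * indicator K y"
    using f unfolding bounded_cs_def by auto
  obtain c :: real where c': "0 \<le> c \<and> (\<forall>f b k x'. f \<in> borel_measurable M \<longrightarrow> (\<forall>y. \<bar>f y\<bar> \<le> b * indicator K y) \<longrightarrow> 0 \<le> b \<longrightarrow>
       integrable M k \<longrightarrow> x' \<in> {x} \<longrightarrow>
       integrable M (\<lambda>y. f y * k (- y + x')) \<and> \<bar>conv f k x'\<bar> \<le> b * c * (\<integral>y. \<bar>k y\<bar> \<partial>M))"
    using conv_bound[OF K(1) compact_sing, of x] by (rule exE)
  note c = conjunct1[OF c'] conjunct2[OF c', rule_format]
  have "\<bar>conv f k x - conv f (g n) x\<bar> \<le> b * c * (\<integral>y. \<bar>k y - g n y\<bar> \<partial>M)" for n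
  proof -
    have "integrable M (\<lambda>y. k y - g n y)" using k g by simp
    then show ?thesis
      using c(2)[OF bounded_cs_measurable[OF f] K(3,2), of "\<lambda>y. k y - g n y" x]
        conv_diff_kernel[OF bounded_cs_conv_integrable[OF f k] bounded_cs_conv_integrable[OF f g]]
      by simp
  qed
  then have le: "eventually (\<lambda>n. norm (conv f k x - conv f (g n) x) \<le> b * c * (\<integral>y. \<bar>k y - g n y\<bar> \<partial>M)) sequentially"
    by simp
  have "(\<lambda>n. b * c * (\<integral>y. \<bar>k y - g n y\<bar> \<partial>M)) \<longlonglongrightarrow> 0"
    using tendsto_mult_left[OF lim, of "b * c"] by simp
  with le have "(\<lambda>n. conv f k x - conv f (g n) x) \<longlonglongrightarrow> 0"
    by (rule Lim_null_comparison)
  then have "(\<lambda>n. conv f k x - (conv f k x - conv f (g n) x)) \<longlonglongrightarrow> conv f k x - 0"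
    by (intro tendsto_diff tendsto_const)
  then show ?thesis by simp
qed

text \<open>\<open>f\<close> may be any Borel function because it sees one coordinate; continuity is
  asked of the factor that mixes the coordinates.\<close>

lemma product_measurable:
  assumes [measurable]: "f \<in> borel_measurable M" and g: "continuous_on UNIV (g :: 'a \<Rightarrow> real)"
  shows "(\<lambda>z. f (fst z) * g (- fst z + snd z)) \<in> borel_measurable (M \<Otimes>\<^sub>M M)"
    "(\<lambda>z. f (snd z) * g (- snd z + fst z)) \<in> borel_measurable (M \<Otimes>\<^sub>M M)"
proof -
  have [measurable]: "(\<lambda>z. g (- fst z + snd z)) \<in> borel_measurable (M \<Otimes>\<^sub>M M)"
    "(\<lambda>z. g (- snd z + fst z)) \<in> borel_measurable (M \<Otimes>\<^sub>M M)"
    by (intro continuous_measurable_pair continuous_on_compose2[OF g] continuous_intros; simp)+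
  show "(\<lambda>z. f (fst z) * g (- fst z + snd z)) \<in> borel_measurable (M \<Otimes>\<^sub>M M)"
    "(\<lambda>z. f (snd z) * g (- snd z + fst z)) \<in> borel_measurable (M \<Otimes>\<^sub>M M)"
    by measurable
qed

text \<open>With a Borel kernel the integrand may fail to be jointly measurable, so the convolution
  is obtained as a pointwise limit of convolutions with continuous kernels.\<close>

lemma conv_measurable:
  assumes f: "bounded_cs f" and k: "integrable M k"
  shows "conv f k \<in> borel_measurable M"
proof -
  obtain g :: "nat \<Rightarrow> 'a \<Rightarrow> real" where g: "\<And>n. continuous_on UNIV (g n)" "\<And>n. integrable M (g n)"
    "(\<lambda>n. \<integral>y. \<bar>k y - g n y\<bar> \<partial>M) \<longlonglongrightarrow> 0"
    using continuous_approximation[OF k] by metis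
  have "conv f (g n) \<in> borel_measurable M" for n
  proof -
    have "(\<lambda>(x, y). f y * g n (- y + x)) \<in> borel_measurable (M \<Otimes>\<^sub>M M)"
      using product_measurable(2)[OF bounded_cs_measurable[OF f] g(1)] by (simp add: case_prod_beta)
    then have "(\<lambda>x. \<integral>y. f y * g n (- y + x) \<partial>M) \<in> borel_measurable M"
      using borel_measurable_lebesgue_integral[of "\<lambda>x y. f y * g n (- y + x)" M] by simp
    then show ?thesis
      by (simp add: conv_def[abs_def])
  qed
  then show ?thesis
    by (rule borel_measurable_LIMSEQ_real[OF conv_tendsto_kernel[OF f k g(2,3)]])
qed

lemma conv_norm_continuous:
  assumes f: "bounded_cs f" and g: "continuous_on UNIV g" "integrable M g"
  shows "(\<integral>\<^sup>+x. ennreal \<bar>conv f g x\<bar> \<partial>M) \<le> ennreal ((\<integral>y. \<bar>f y\<bar> \<partial>M) * (\<integral>y. \<bar>g y\<bar> \<partial>M))"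
proof -
  note [measurable] = bounded_cs_measurable[OF f]
  have [measurable]: "g \<in> borel_measurable M"
    using g(2) by auto
  have "(\<integral>\<^sup>+x. ennreal \<bar>conv f g x\<bar> \<partial>M) \<le> (\<integral>\<^sup>+x. (\<integral>\<^sup>+y. ennreal \<bar>f y * g (- y + x)\<bar> \<partial>M) \<partial>M)"
    using integral_norm_bound_ennreal[OF bounded_cs_conv_integrable[OF f g(2)]]
    by (intro nn_integral_mono) (simp add: conv_def)
  also have "\<dots> = (\<integral>\<^sup>+y. (\<integral>\<^sup>+x. ennreal \<bar>f y * g (- y + x)\<bar> \<partial>M) \<partial>M)"
    using product_measurable(1)[of f g] g by (intro pair.Fubini') (simp add: case_prod_beta)
  also have "\<dots> = (\<integral>\<^sup>+y. ennreal \<bar>f y\<bar> * (\<integral>\<^sup>+x. ennreal \<bar>g x\<bar> \<partial>M) \<partial>M)"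
  proof (rule nn_integral_cong)
    fix y
    have "(\<integral>\<^sup>+x. ennreal \<bar>f y * g (- y + x)\<bar> \<partial>M) = ennreal \<bar>f y\<bar> * (\<integral>\<^sup>+x. ennreal \<bar>g (- y + x)\<bar> \<partial>M)"
      unfolding abs_mult by (subst nn_integral_cmult[symmetric]) (auto simp: ennreal_mult)
    also have "(\<integral>\<^sup>+x. ennreal \<bar>g (- y + x)\<bar> \<partial>M) = (\<integral>\<^sup>+x. ennreal \<bar>g x\<bar> \<partial>M)"
      by (rule nn_integral_translate) auto
    finally show "(\<integral>\<^sup>+x. ennreal \<bar>f y * g (- y + x)\<bar> \<partial>M) = ennreal \<bar>f y\<bar> * (\<integral>\<^sup>+x. ennreal \<bar>g x\<bar> \<partial>M)" .
  qed
  also have "\<dots> = (\<integral>\<^sup>+y. ennreal \<bar>f y\<bar> \<partial>M) * (\<integral>\<^sup>+x. ennreal \<bar>g x\<bar> \<partial>M)"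
    by (rule nn_integral_multc) auto
  also have "(\<integral>\<^sup>+y. ennreal \<bar>f y\<bar> \<partial>M) = ennreal (\<integral>y. \<bar>f y\<bar> \<partial>M)"
    using bounded_cs_integrable[OF f] by (intro nn_integral_eq_integral) auto
  also have "(\<integral>\<^sup>+y. ennreal \<bar>g y\<bar> \<partial>M) = ennreal (\<integral>y. \<bar>g y\<bar> \<partial>M)"
    using g by (intro nn_integral_eq_integral) auto
  finally show ?thesis
    by (simp add: ennreal_mult)
qed

text \<open>Fatou's lemma carries the bound over from continuous kernels, since the convolutions
  converge at every point.\<close>

lemma conv_norm:
  assumes f: "bounded_cs f" and k: "integrable M k"
  shows "(\<integral>\<^sup>+x. ennreal \<bar>conv f k x\<bar> \<partial>M) \<le> ennreal ((\<integral>y. \<bar>f y\<bar> \<partial>M) * (\<integral>y. \<bar>k y\<bar> \<partial>M))"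
proof -
  obtain g :: "nat \<Rightarrow> 'a \<Rightarrow> real" where g: "\<And>n. continuous_on UNIV (g n)" "\<And>n. integrable M (g n)"
    "(\<lambda>n. \<integral>y. \<bar>k y - g n y\<bar> \<partial>M) \<longlonglongrightarrow> 0"
    using continuous_approximation[OF k] by metis
  define F where "F = (\<integral>y. \<bar>f y\<bar> \<partial>M)"
  define d where "d n = (\<integral>y. \<bar>k y - g n y\<bar> \<partial>M)" for n
  have F: "0 \<le> F" unfolding F_def by simp
  have gn: "(\<integral>y. \<bar>g n y\<bar> \<partial>M) \<le> (\<integral>y. \<bar>k y\<bar> \<partial>M) + d n" for n
  proof -
    have "(\<integral>y. \<bar>g n y\<bar> \<partial>M) \<le> (\<integral>y. \<bar>k y\<bar> + \<bar>k y - g n y\<bar> \<partial>M)"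
      using k g(2) by (intro integral_mono) auto
    also have "\<dots> = (\<integral>y. \<bar>k y\<bar> \<partial>M) + d n"
      unfolding d_def using k g(2) by simp
    finally show ?thesis .
  qed
  have "(\<lambda>n. F * ((\<integral>y. \<bar>k y\<bar> \<partial>M) + d n)) \<longlonglongrightarrow> F * ((\<integral>y. \<bar>k y\<bar> \<partial>M) + 0)"
    using g(3) unfolding d_def by (intro tendsto_intros)
  then have lim: "(\<lambda>n. ennreal (F * ((\<integral>y. \<bar>k y\<bar> \<partial>M) + d n))) \<longlonglongrightarrow> ennreal (F * (\<integral>y. \<bar>k y\<bar> \<partial>M))"
    by (intro tendsto_ennrealI) simp
  have m: "(\<lambda>x. ennreal \<bar>conv f (g n) x\<bar>) \<in> borel_measurable M" for n
    using conv_measurable[OF f g(2)] by simp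
  have "(\<lambda>n. ennreal \<bar>conv f (g n) x\<bar>) \<longlonglongrightarrow> ennreal \<bar>conv f k x\<bar>" for x
    using conv_tendsto_kernel[OF f k g(2,3)] by (intro tendsto_ennrealI tendsto_rabs)
  then have "(\<integral>\<^sup>+x. ennreal \<bar>conv f k x\<bar> \<partial>M) = (\<integral>\<^sup>+x. liminf (\<lambda>n. ennreal \<bar>conv f (g n) x\<bar>) \<partial>M)"
    by (intro nn_integral_cong lim_imp_Liminf[symmetric]) auto
  also have "\<dots> \<le> liminf (\<lambda>n. \<integral>\<^sup>+x. ennreal \<bar>conv f (g n) x\<bar> \<partial>M)"
    by (rule nn_integral_liminf[OF m])
  also have "\<dots> \<le> liminf (\<lambda>n. ennreal (F * ((\<integral>y. \<bar>k y\<bar> \<partial>M) + d n)))"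
  proof (intro Liminf_mono always_eventually allI)
    fix n
    show "(\<integral>\<^sup>+x. ennreal \<bar>conv f (g n) x\<bar> \<partial>M) \<le> ennreal (F * ((\<integral>y. \<bar>k y\<bar> \<partial>M) + d n))"
      using gn[of n] F unfolding F_def[symmetric]
      by (intro order_trans[OF conv_norm_continuous[OF f g(1,2)], folded F_def] ennreal_leI mult_left_mono)
  qed
  also have "\<dots> = ennreal (F * (\<integral>y. \<bar>k y\<bar> \<partial>M))"
    using lim by (intro lim_imp_Liminf) auto
  finally show ?thesis
    unfolding F_def .
qed

text \<open>For unbounded \<open>f\<close> the convolution integral may diverge on a null set. Its
  absolute convergence elsewhere follows without joint measurability: the integral \<open>u\<close>
  of the absolute values is an increasing limit of convolutions of bounded functions, whose L1 norms
  \<open>conv_norm\<close> controls. Where \<open>u\<close> is finite, dominated convergence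
  applies.\<close>

lemma conv_truncate_tendsto:
  assumes f: "integrable M f" and k: "integrable M k"
    and K: "\<And>n. compact (K n)" "incseq K" "(\<Union>n. K n) = UNIV"
  defines "fn \<equiv> \<lambda>n y. indicator (K n \<inter> {y. \<bar>f y\<bar> \<le> real n}) y * f y"
  shows "AE x in M. (\<lambda>n. conv (fn n) k x) \<longlonglongrightarrow> conv f k x"
proof -
  have [measurable]: "f \<in> borel_measurable M" "k \<in> borel_measurable M"
    using f k by auto
  have [measurable]: "K n \<in> sets M" for n
    using K(1) by (rule compact_sets)
  have fm [measurable]: "fn n \<in> borel_measurable M" for n
    unfolding fn_def by measurable
  have fb: "bounded_cs (fn n)" for n
    unfolding bounded_cs_def
    by (intro conjI exI[of _ "K n"] exI[of _ "real n"] K fm) (auto simp: fn_def indicator_def)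
  have ab: "\<bar>fn n y\<bar> \<le> \<bar>f y\<bar>" for n y
    by (auto simp: fn_def indicator_def)
  have ev: "eventually (\<lambda>n. fn n y = f y) sequentially" for y
  proof -
    obtain n0 where n0: "y \<in> K n0" using K(3) by blast
    obtain n1 where n1: "\<bar>f y\<bar> \<le> real n1" using real_arch_simple by blast
    show ?thesis
    proof (rule eventually_sequentiallyI[of "max n0 n1"])
      fix n assume n: "max n0 n1 \<le> n"
      then have "y \<in> K n" using n0 incseqD[OF K(2), of n0 n] by auto
      then show "fn n y = f y" using n n1 by (auto simp: fn_def)
    qed
  qed
  have inc: "\<bar>fn n y\<bar> \<le> \<bar>fn n' y\<bar>" if "n \<le> n'" for n n' y
    using incseqD[OF K(2) that] that by (auto simp: fn_def indicator_def)
  define u where "u x = (\<integral>\<^sup>+y. ennreal \<bar>f y * k (- y + x)\<bar> \<partial>M)" for x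
  have un: "(\<integral>\<^sup>+y. ennreal \<bar>fn n y * k (- y + x)\<bar> \<partial>M) = ennreal \<bar>conv (\<lambda>y. \<bar>fn n y\<bar>) (\<lambda>y. \<bar>k y\<bar>) x\<bar>" for n x
  proof -
    have "integrable M (\<lambda>y. \<bar>fn n y * k (- y + x)\<bar>)"
      using bounded_cs_conv_integrable[OF fb k] by simp
    then have "(\<integral>\<^sup>+y. ennreal \<bar>fn n y * k (- y + x)\<bar> \<partial>M) = ennreal (\<integral>y. \<bar>fn n y * k (- y + x)\<bar> \<partial>M)"
      by (intro nn_integral_eq_integral) auto
    then show ?thesis
      by (simp add: conv_def abs_mult)
  qed
  have fab: "bounded_cs (\<lambda>y. \<bar>fn n y\<bar>)" for n
    by (rule bounded_cs_mono[OF fb]) auto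
  have ka: "integrable M (\<lambda>y. \<bar>k y\<bar>)" using k by simp
  have usup: "u x = (SUP n. ennreal \<bar>conv (\<lambda>y. \<bar>fn n y\<bar>) (\<lambda>y. \<bar>k y\<bar>) x\<bar>)" for x
  proof -
    have "u x = (\<integral>\<^sup>+y. (SUP n. ennreal \<bar>fn n y * k (- y + x)\<bar>) \<partial>M)"
      unfolding u_def
    proof (intro nn_integral_cong antisym SUP_least ennreal_leI)
      fix y
      obtain n where "fn n y = f y"
        using ev[of y] by (auto simp: eventually_sequentially)
      then show "ennreal \<bar>f y * k (- y + x)\<bar> \<le> (SUP n. ennreal \<bar>fn n y * k (- y + x)\<bar>)"
        by (intro SUP_upper2[of n]) auto
    next
      fix y n
      show "\<bar>fn n y * k (- y + x)\<bar> \<le> \<bar>f y * k (- y + x)\<bar>"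
        unfolding abs_mult by (intro mult_right_mono ab) auto
    qed
    also have "\<dots> = (SUP n. \<integral>\<^sup>+y. ennreal \<bar>fn n y * k (- y + x)\<bar> \<partial>M)"
      by (intro nn_integral_monotone_convergence_SUP)
         (auto simp: incseq_def le_fun_def abs_mult intro!: ennreal_leI mult_right_mono inc)
    finally show ?thesis unfolding un .
  qed
  have cm: "(\<lambda>x. ennreal \<bar>conv (\<lambda>y. \<bar>fn n y\<bar>) (\<lambda>y. \<bar>k y\<bar>) x\<bar>) \<in> borel_measurable M" for n
    using conv_measurable[OF fab ka] by simp
  have um: "u \<in> borel_measurable M"
    unfolding usup[abs_def] using cm by (intro borel_measurable_SUP) auto
  have "(\<integral>\<^sup>+x. u x \<partial>M) = (SUP n. \<integral>\<^sup>+x. ennreal \<bar>conv (\<lambda>y. \<bar>fn n y\<bar>) (\<lambda>y. \<bar>k y\<bar>) x\<bar> \<partial>M)"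
    unfolding usup
  proof (intro nn_integral_monotone_convergence_SUP cm, unfold un[symmetric])
    show "incseq (\<lambda>n x. \<integral>\<^sup>+y. ennreal \<bar>fn n y * k (- y + x)\<bar> \<partial>M)"
      by (auto simp: incseq_def le_fun_def abs_mult intro!: nn_integral_mono ennreal_leI mult_right_mono inc)
  qed
  also have "\<dots> \<le> ennreal ((\<integral>y. \<bar>f y\<bar> \<partial>M) * (\<integral>y. \<bar>k y\<bar> \<partial>M))"
  proof (rule SUP_least)
    fix n
    have "(\<integral>y. \<bar>fn n y\<bar> \<partial>M) \<le> (\<integral>y. \<bar>f y\<bar> \<partial>M)"
      using bounded_cs_integrable[OF fb] f ab by (intro integral_mono) auto
    then show "(\<integral>\<^sup>+x. ennreal \<bar>conv (\<lambda>y. \<bar>fn n y\<bar>) (\<lambda>y. \<bar>k y\<bar>) x\<bar> \<partial>M)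
        \<le> ennreal ((\<integral>y. \<bar>f y\<bar> \<partial>M) * (\<integral>y. \<bar>k y\<bar> \<partial>M))"
      by (intro order_trans[OF conv_norm[OF fab ka]] ennreal_leI) (auto intro!: mult_right_mono)
  qed
  finally have "(\<integral>\<^sup>+x. u x \<partial>M) \<noteq> \<infinity>"
    by (auto simp: top_unique)
  then have "AE x in M. u x \<noteq> \<infinity>"
    by (rule nn_integral_noteq_infinite[OF um])
  then show ?thesis
  proof (rule AE_mp, intro AE_I2 impI)
    fix x assume ux: "u x \<noteq> \<infinity>"
    have i: "integrable M (\<lambda>y. f y * k (- y + x))"
      using ux unfolding u_def by (intro integrableI_bounded) (auto simp: less_top)
    show "(\<lambda>n. conv (fn n) k x) \<longlonglongrightarrow> conv f k x"
      unfolding conv_def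
    proof (rule integral_dominated_convergence[where w="\<lambda>y. \<bar>f y * k (- y + x)\<bar>"])
      show "integrable M (\<lambda>y. \<bar>f y * k (- y + x)\<bar>)" using i by simp
      show "AE y in M. (\<lambda>n. fn n y * k (- y + x)) \<longlonglongrightarrow> f y * k (- y + x)"
      proof (rule AE_I2)
        fix y
        show "(\<lambda>n. fn n y * k (- y + x)) \<longlonglongrightarrow> f y * k (- y + x)"
          by (rule tendsto_eventually) (use ev[of y] in \<open>auto elim!: eventually_mono\<close>)
      qed
      show "AE y in M. norm (fn n y * k (- y + x)) \<le> \<bar>f y * k (- y + x)\<bar>" for n
        by (rule AE_I2) (auto simp: abs_mult intro!: mult_right_mono ab)
    qed measurable
  qed
qed

section \<open>Weak type estimates\<close>

lemma conv_diff:
  assumes "bounded_cs f" "bounded_cs g" "integrable M k"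
  shows "conv (\<lambda>y. f y - g y) k x = conv f k x - conv g k x"
  using bounded_cs_conv_integrable[OF assms(1,3), of x] bounded_cs_conv_integrable[OF assms(2,3), of x]
  by (simp add: conv_def left_diff_distrib)

lemma conv_sum:
  assumes "\<And>i. i \<in> I \<Longrightarrow> bounded_cs (f i)" "integrable M k"
  shows "conv (\<lambda>y. \<Sum>i\<in>I. f i y) k x = (\<Sum>i\<in>I. conv (f i) k x)"
  using bounded_cs_conv_integrable[OF assms(1) assms(2), of _ x]
  by (simp add: conv_def sum_distrib_right)

lemma conv_divide: "conv (\<lambda>y. f y / c) k x = conv f k x / c"
  by (simp add: conv_def)

definition maxop :: "(nat \<Rightarrow> 'a \<Rightarrow> real) \<Rightarrow> ('a \<Rightarrow> real) \<Rightarrow> 'a \<Rightarrow> ereal" where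
  "maxop \<kappa> f x = (SUP j. ereal \<bar>conv f (\<kappa> j) x\<bar>)"

lemma less_maxop_iff: "ereal t < maxop \<kappa> f x \<longleftrightarrow> (\<exists>j. t < \<bar>conv f (\<kappa> j) x\<bar>)"
  by (simp add: maxop_def less_SUP_iff)

lemma level_set_measurable:
  assumes "bounded_cs f" "\<And>j. integrable M (\<kappa> j)"
  shows "{x. ereal t < maxop \<kappa> f x} \<in> sets M"
proof -
  have [measurable]: "conv f (\<kappa> j) \<in> borel_measurable M" for j
    using conv_measurable[OF assms] .
  have "{x \<in> space M. \<exists>j. t < \<bar>conv f (\<kappa> j) x\<bar>} \<in> sets M"
    by measurable
  then show ?thesis
    by (simp add: less_maxop_iff)
qed

text \<open>The passage from sets to functions: on compact sets, finitely many of the convolutions do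
  not distinguish \<open>f / A\<close> from a suitable characteristic function.\<close>

lemma weak_type_nonneg:
  assumes \<kappa>: "\<And>j. integrable M (\<kappa> j)"
    and rw: "\<And>E t. E \<in> sets M \<Longrightarrow> emeasure M E < \<infinity> \<Longrightarrow> 0 < t \<Longrightarrow>
      emeasure M {x. ereal t < maxop \<kappa> (indicator E) x} \<le> ennreal (D * t powr (- p)) * emeasure M E"
    and D: "0 \<le> D" and K: "compact K" and A: "0 < A"
    and f: "f \<in> borel_measurable M" "\<And>y. 0 \<le> f y" "\<And>y. f y \<le> A * indicator K y"
    and t: "0 < t"
  shows "emeasure M {x. ereal t < maxop \<kappa> f x} \<le> ennreal (D * (t / A) powr (- p) * ((\<integral>y. f y \<partial>M) / A))"
proof -
  obtain L :: "nat \<Rightarrow> 'a set" where L: "\<And>n. compact (L n)" "incseq L" "(\<Union>n. L n) = UNIV"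
    using exhaustion by metis
  have fb: "bounded_cs f"
    unfolding bounded_cs_def using f K A
    by (intro conjI exI[of _ K] exI[of _ A]) auto
  have cm [measurable]: "conv f (\<kappa> j) \<in> borel_measurable M" for j
    using conv_measurable[OF fb \<kappa>] .
  \<comment> \<open>The approximation by sets treats a compact set of points and finitely many
    kernels at a time; these sets increase to the level set.\<close>
  define S where "S n = L n \<inter> {x. \<exists>j<n. t < \<bar>conv f (\<kappa> j) x\<bar>}" for n
  have S: "S n \<in> sets M" for n
  proof -
    have "{x \<in> space M. \<exists>j\<in>{..<n}. t < \<bar>conv f (\<kappa> j) x\<bar>} \<in> sets M"
      by measurable
    moreover have "L n \<in> sets M"
      by (rule compact_sets[OF L(1)])
    ultimately show ?thesis
      unfolding S_def by (simp add: Bex_def)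
  qed
  have incS: "incseq S"
    unfolding incseq_def S_def
    using incseqD[OF L(2)] by (fastforce intro: less_le_trans)
  have US: "(\<Union>n. S n) = {x. ereal t < maxop \<kappa> f x}"
  proof (intro equalityI subsetI)
    fix x assume "x \<in> {x. ereal t < maxop \<kappa> f x}"
    then obtain j where j: "t < \<bar>conv f (\<kappa> j) x\<bar>"
      by (auto simp: less_maxop_iff)
    obtain n where n: "x \<in> L n"
      using L(3) by blast
    have "x \<in> L (max n (Suc j))"
      using n incseqD[OF L(2), of n "max n (Suc j)"] by auto
    then have "x \<in> S (max n (Suc j))"
      unfolding S_def using j by (auto intro!: exI[of _ j])
    then show "x \<in> (\<Union>n. S n)" by blast
  qed (auto simp: S_def less_maxop_iff)
  have le: "emeasure M (S n) \<le> ennreal (D * (t / A) powr (- p) * ((\<integral>y. f y \<partial>M) / A))" for n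
  proof -
    \<comment> \<open>Admissible errors that tend to 0 and stay below \<open>t / A\<close>, so that
      the lowered level \<open>t / A - d i\<close> is positive.\<close>
    define d where "d i = t / A / (real i + 2)" for i :: nat
    have d: "0 < d i" "d i < t / A" for i
      using t A by (auto simp: d_def divide_simps)
    have "emeasure M (S n) \<le> ennreal (D * (t / A - d i) powr (- p) * ((\<integral>y. f y \<partial>M) / A))" for i
    proof -
      have fA: "(\<lambda>y. f y / A) \<in> borel_measurable M" "\<And>y. 0 \<le> f y / A" "\<And>y. f y / A \<le> indicator K y"
        using f A by (auto simp: divide_simps mult.commute)
      obtain E where E': "E \<in> sets M" "E \<subseteq> K \<and> measure M E \<le> (\<integral>y. f y / A \<partial>M) \<and>
        (\<forall>j\<in>{..<n}. \<forall>x\<in>L n.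
          \<bar>conv (\<lambda>y. f y / A) (\<kappa> j) x - conv (indicator E) (\<kappa> j) x\<bar> \<le> d i)"
        using set_approximation_conv[OF K L(1) finite_lessThan fA \<kappa> d(1)] by (rule bexE)
      note E = E'(1) E'(2)[THEN conjunct1] E'(2)[THEN conjunct2, THEN conjunct1]
        E'(2)[THEN conjunct2, THEN conjunct2, rule_format]
      have Efin: "emeasure M E < \<infinity>"
        using emeasure_mono[OF E(2) compact_sets[OF K]] compact_finite[OF K] by (rule le_less_trans)
      have Eb: "bounded_cs (indicator E)"
        unfolding bounded_cs_def using E K
        by (intro conjI exI[of _ K] exI[of _ 1]) (auto simp: indicator_def)
      have "S n \<subseteq> {x. ereal (t / A - d i) < maxop \<kappa> (indicator E) x}"
      proof
        fix x assume "x \<in> S n"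
        then obtain j where j: "j < n" "x \<in> L n" "t < \<bar>conv f (\<kappa> j) x\<bar>"
          unfolding S_def by auto
        have "t / A < \<bar>conv (\<lambda>y. f y / A) (\<kappa> j) x\<bar>"
          using j(3) A by (simp add: conv_divide divide_strict_right_mono)
        moreover have "\<bar>conv (\<lambda>y. f y / A) (\<kappa> j) x - conv (indicator E) (\<kappa> j) x\<bar> \<le> d i"
          using j by (intro E(4)) auto
        ultimately have "t / A - d i < \<bar>conv (indicator E) (\<kappa> j) x\<bar>"
          by linarith
        then show "x \<in> {x. ereal (t / A - d i) < maxop \<kappa> (indicator E) x}"
          by (auto simp: less_maxop_iff)
      qed
      then have "emeasure M (S n) \<le> emeasure M {x. ereal (t / A - d i) < maxop \<kappa> (indicator E) x}"
        by (intro emeasure_mono level_set_measurable Eb \<kappa>)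
      also have "\<dots> \<le> ennreal (D * (t / A - d i) powr (- p)) * emeasure M E"
        using d by (intro rw E Efin) auto
      also have "\<dots> \<le> ennreal (D * (t / A - d i) powr (- p)) * ennreal ((\<integral>y. f y \<partial>M) / A)"
        using Efin E(3) by (intro mult_left_mono) (auto simp: emeasure_eq_ennreal_measure less_top ennreal_leI)
      also have "\<dots> = ennreal (D * (t / A - d i) powr (- p) * ((\<integral>y. f y \<partial>M) / A))"
        using D by (subst ennreal_mult') (auto)
      finally show ?thesis .
    qed
    moreover have "(\<lambda>i. ennreal (D * (t / A - d i) powr (- p) * ((\<integral>y. f y \<partial>M) / A)))
        \<longlonglongrightarrow> ennreal (D * (t / A - 0) powr (- p) * ((\<integral>y. f y \<partial>M) / A))"
    proof -
      have "(\<lambda>i. t / A * inverse (real (Suc (Suc i)))) \<longlonglongrightarrow> t / A * 0"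
        by (intro tendsto_mult_left LIMSEQ_Suc[OF LIMSEQ_inverse_real_of_nat])
      then have "d \<longlonglongrightarrow> 0"
        by (simp add: d_def[abs_def] divide_inverse add.commute)
      then have "(\<lambda>i. t / A - d i) \<longlonglongrightarrow> t / A - 0"
        by (intro tendsto_diff tendsto_const)
      then have "(\<lambda>i. (t / A - d i) powr (- p)) \<longlonglongrightarrow> (t / A - 0) powr (- p)"
        by (rule tendsto_powr[OF _ tendsto_const]) (use t A in simp)
      then show ?thesis
        by (intro tendsto_ennrealI tendsto_mult tendsto_const)
    qed
    ultimately show ?thesis
      by (intro LIMSEQ_le_const[of "\<lambda>i. ennreal (D * (t / A - d i) powr (- p) * ((\<integral>y. f y \<partial>M) / A))"]) auto
  qed
  have "emeasure M {x. ereal t < maxop \<kappa> f x} = (SUP n. emeasure M (S n))"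
    unfolding US[symmetric] using S incS by (intro SUP_emeasure_incseq[symmetric]) auto
  also have "\<dots> \<le> ennreal (D * (t / A) powr (- p) * ((\<integral>y. f y \<partial>M) / A))"
    by (intro SUP_least le)
  finally show ?thesis .
qed

text \<open>Positive and negative part each get half of the level, whence \<open>2 * A\<close>.
  Their integrals add up to that of \<open>\<bar>f y\<bar>\<close>, so no further constant
  arises.\<close>

lemma weak_type_bounded:
  assumes \<kappa>: "\<And>j. integrable M (\<kappa> j)"
    and rw: "\<And>E t. E \<in> sets M \<Longrightarrow> emeasure M E < \<infinity> \<Longrightarrow> 0 < t \<Longrightarrow>
      emeasure M {x. ereal t < maxop \<kappa> (indicator E) x} \<le> ennreal (D * t powr (- p)) * emeasure M E"
    and D: "0 \<le> D" and f: "bounded_cs f" and A: "0 < A" "\<And>y. \<bar>f y\<bar> \<le> A"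
    and t: "0 < t"
  shows "emeasure M {x. ereal t < maxop \<kappa> f x}
    \<le> ennreal (D * (t / (2 * A)) powr (- p) * ((\<integral>y. \<bar>f y\<bar> \<partial>M) / A))"
proof -
  obtain K b where K: "compact K" "0 \<le> b" "\<And>y. \<bar>f y\<bar> \<le> b * indicator K y"
    using f unfolding bounded_cs_def by auto
  have fK: "\<bar>f y\<bar> \<le> A * indicator K y" for y
    using K(3)[of y] A(2)[of y] by (cases "y \<in> K") auto
  define g h where "g y = max (f y) 0" and "h y = max (- f y) 0" for y
  have fm [measurable]: "f \<in> borel_measurable M"
    by (rule bounded_cs_measurable[OF f])
  have gm: "g \<in> borel_measurable M" "h \<in> borel_measurable M"
    unfolding g_def h_def by measurable
  have gb: "bounded_cs g" "bounded_cs h"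
    by (rule bounded_cs_mono[OF f]; use gm in \<open>auto simp: g_def h_def\<close>)+
  have fgh: "f = (\<lambda>y. g y - h y)" "\<bar>f y\<bar> = g y + h y" for y
    by (auto simp: g_def h_def fun_eq_iff)
  have gK: "0 \<le> g y" "g y \<le> A * indicator K y" "0 \<le> h y" "h y \<le> A * indicator K y" for y
    using fK[of y] A(1) by (auto simp: g_def h_def)
  have "{x. ereal t < maxop \<kappa> f x} \<subseteq> {x. ereal (t / 2) < maxop \<kappa> g x} \<union> {x. ereal (t / 2) < maxop \<kappa> h x}"
  proof
    fix x assume "x \<in> {x. ereal t < maxop \<kappa> f x}"
    then obtain j where "t < \<bar>conv f (\<kappa> j) x\<bar>"
      by (auto simp: less_maxop_iff)
    moreover have "conv f (\<kappa> j) x = conv g (\<kappa> j) x - conv h (\<kappa> j) x"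
      by (subst fgh(1)) (rule conv_diff[OF gb \<kappa>])
    ultimately have "t / 2 < \<bar>conv g (\<kappa> j) x\<bar> \<or> t / 2 < \<bar>conv h (\<kappa> j) x\<bar>"
      by linarith
    then show "x \<in> {x. ereal (t / 2) < maxop \<kappa> g x} \<union> {x. ereal (t / 2) < maxop \<kappa> h x}"
      by (auto simp: less_maxop_iff)
  qed
  then have "emeasure M {x. ereal t < maxop \<kappa> f x}
      \<le> emeasure M ({x. ereal (t / 2) < maxop \<kappa> g x} \<union> {x. ereal (t / 2) < maxop \<kappa> h x})"
    by (intro emeasure_mono sets.Un level_set_measurable gb \<kappa>)
  also have "\<dots> \<le> emeasure M {x. ereal (t / 2) < maxop \<kappa> g x} + emeasure M {x. ereal (t / 2) < maxop \<kappa> h x}"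
    by (intro emeasure_subadditive level_set_measurable gb \<kappa>)
  also have "\<dots> \<le> ennreal (D * (t / 2 / A) powr (- p) * ((\<integral>y. g y \<partial>M) / A))
      + ennreal (D * (t / 2 / A) powr (- p) * ((\<integral>y. h y \<partial>M) / A))"
    using t gK by (intro add_mono weak_type_nonneg[OF \<kappa> rw D K(1) A(1)] gm) auto
  also have "\<dots> = ennreal (D * (t / 2 / A) powr (- p) * ((\<integral>y. g y \<partial>M) / A)
      + D * (t / 2 / A) powr (- p) * ((\<integral>y. h y \<partial>M) / A))"
    using D A gK by (intro ennreal_plus[symmetric]) (auto intro!: mult_nonneg_nonneg divide_nonneg_pos)
  also have "D * (t / 2 / A) powr (- p) * ((\<integral>y. g y \<partial>M) / A) + D * (t / 2 / A) powr (- p) * ((\<integral>y. h y \<partial>M) / A)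
      = D * (t / (2 * A)) powr (- p) * ((\<integral>y. \<bar>f y\<bar> \<partial>M) / A)"
    unfolding fgh(2) using bounded_cs_integrable[OF gb(1)] bounded_cs_integrable[OF gb(2)]
    by (simp add: add_divide_distrib distrib_left)
  finally show ?thesis .
qed

text \<open>As \<open>2 ^ Suc i\<close> is the reciprocal of the level, this is a bound of weak type
  1 with constant \<open>D * 2 powr (m * k)\<close>, restricted to levels and heights tied to
  \<open>k\<close>. The exponent varies with \<open>k\<close>, while \<open>D\<close> serves all
  \<open>k\<close>, \<open>i\<close> and \<open>f\<close>.\<close>

lemma weak_type_piece:
  fixes r C m :: real
  assumes \<kappa>: "\<And>j. integrable M (\<kappa> j)"
    and rw: "\<And>p. 1 < p \<Longrightarrow> p < r \<Longrightarrow> \<exists>Cp \<le> (C / (p - 1)) powr (m * p). \<forall>E\<in>sets M. emeasure M E < \<infinity> \<longrightarrow>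
      (\<forall>t>0. emeasure M {x. ereal t < maxop \<kappa> (indicator E) x} \<le> ennreal (Cp * t powr (- p)) * emeasure M E)"
    and r: "1 < r" and C: "0 < C" and m: "0 < m"
  shows "\<exists>D>0. \<forall>k i f. i < levels k \<longrightarrow> bounded_cs f \<longrightarrow> (\<forall>y. \<bar>f y\<bar> \<le> 2 ^ 2 ^ Suc k) \<longrightarrow>
    emeasure M {x. ereal ((1/2) ^ Suc i) < maxop \<kappa> f x}
      \<le> ennreal (D * 2 powr (m * k) * 2 ^ Suc i * (\<integral>y. \<bar>f y\<bar> \<partial>M))"
proof -
  \<comment> \<open>Keeps all exponents \<open>1 + s0 / 2 ^ k\<close> below
    \<open>r\<close>.\<close>
  define s0 where "s0 = min 1 ((r - 1) / 2)"
  define B0 where "B0 = max 1 (C / s0)"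
  define D where "D = B0 powr (2 * m) * 2 powr m * 256"
  have s0: "0 < s0" "s0 \<le> 1" "1 + s0 < r"
    using r by (auto simp: s0_def min_def field_simps)
  have B0: "1 \<le> B0" "C \<le> B0 * s0"
    using s0(1) by (auto simp: B0_def max_def field_simps)
  have D: "0 < D"
    unfolding D_def using B0 by simp
  have "emeasure M {x. ereal ((1/2) ^ Suc i) < maxop \<kappa> f x}
      \<le> ennreal (D * 2 powr (m * k) * 2 ^ Suc i * (\<integral>y. \<bar>f y\<bar> \<partial>M))"
    if i: "i < levels k" and f: "bounded_cs f" and fA: "\<And>y. \<bar>f y\<bar> \<le> 2 ^ 2 ^ Suc k" for k i f
  proof -
    define s where "s = s0 / 2 ^ k"
    define A :: real where "A = 2 ^ 2 ^ Suc k"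
    define D' where "D' = (C / s) powr (m * (1 + s))"
    have "s \<le> s0"
      unfolding s_def using s0 by (simp add: divide_le_eq)
    then have s: "0 < s" "1 + s < r"
      using s0 by (auto simp: s_def)
    obtain Cp where Cp: "Cp \<le> D'" "\<And>E t. E \<in> sets M \<Longrightarrow> emeasure M E < \<infinity> \<Longrightarrow> 0 < t \<Longrightarrow>
        emeasure M {x. ereal t < maxop \<kappa> (indicator E) x} \<le> ennreal (Cp * t powr (- (1 + s))) * emeasure M E"
      using rw[of "1 + s"] s unfolding D'_def by auto
    have rw': "emeasure M {x. ereal t < maxop \<kappa> (indicator E) x} \<le> ennreal (D' * t powr (- (1 + s))) * emeasure M E"
      if "E \<in> sets M" "emeasure M E < \<infinity>" "0 < t" for E t
      using Cp(1) by (intro order_trans[OF Cp(2)[OF that]] mult_right_mono ennreal_leI) auto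
    have "emeasure M {x. ereal ((1/2) ^ Suc i) < maxop \<kappa> f x}
        \<le> ennreal (D' * ((1/2) ^ Suc i / (2 * A)) powr (- (1 + s)) * ((\<integral>y. \<bar>f y\<bar> \<partial>M) / A))"
      by (rule weak_type_bounded[OF \<kappa> rw' _ f]) (use fA in \<open>auto simp: D'_def A_def\<close>)
    also have "\<dots> = ennreal (D' * ((1/2) ^ Suc i / (2 * A)) powr (- (1 + s)) / A * (\<integral>y. \<bar>f y\<bar> \<partial>M))"
      by (simp only: times_divide_eq_right times_divide_eq_left)
    also have "\<dots> \<le> ennreal (D * 2 powr (m * k) * 2 ^ Suc i * (\<integral>y. \<bar>f y\<bar> \<partial>M))"
    proof (intro ennreal_leI mult_right_mono)
      have "i \<le> 2 * k + 1"
        using i levels_le[of k] by linarith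
      then show "D' * ((1/2) ^ Suc i / (2 * A)) powr (- (1 + s)) / A \<le> D * 2 powr (m * k) * 2 ^ Suc i"
        unfolding D'_def A_def s_def D_def
        by (rule exponent_choice_bound[OF s0(1,2) B0 C m])
    qed simp
    finally show ?thesis .
  qed
  then show ?thesis
    using D by (intro exI[of _ D]) blast
qed

text \<open>\<open>24 = 2 * 2 * 6\<close>: Markov's inequality at the value 1/2, the ratio of the
  weight \<open>(1/2) ^ i\<close> to the level \<open>(1/2) ^ Suc i\<close>, and the constant of
  \<open>sum_weighted_piece_le\<close>.\<close>

lemma phi_type_bounded:
  assumes \<kappa>: "\<And>j. integrable M (\<kappa> j)" and m: "0 < m" and D: "0 < D"
    and piece_bound: "\<And>k i f. i < levels k \<Longrightarrow> bounded_cs f \<Longrightarrow> (\<And>y. \<bar>f y\<bar> \<le> 2 ^ 2 ^ Suc k) \<Longrightarrow>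
      emeasure M {x. ereal ((1/2) ^ Suc i) < maxop \<kappa> f x}
        \<le> ennreal (D * 2 powr (m * k) * 2 ^ Suc i * (\<integral>y. \<bar>f y\<bar> \<partial>M))"
    and f: "bounded_cs f"
  shows "emeasure M {x. ereal 1 < maxop \<kappa> f x} \<le> ennreal (24 * D) * (\<integral>\<^sup>+y. ennreal (antonov_phi m \<bar>f y\<bar>) \<partial>M)"
proof -
  obtain K b where K: "compact K" "0 \<le> b" "\<And>y. \<bar>f y\<bar> \<le> b * indicator K y"
    using f unfolding bounded_cs_def by auto
  have fb: "\<bar>f y\<bar> \<le> b" for y
    using K(3)[of y] K(2) by (cases "y \<in> K") auto
  \<comment> \<open>A bounded function has finitely many nonzero pieces; their number
    \<open>n\<close> does not enter the constant.\<close>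
  obtain n0 :: nat where n0: "b < 2 ^ n0"
    using real_arch_pow[of 2 b] by auto
  define n where "n = Suc n0"
  have n: "1 \<le> n"
    by (simp add: n_def)
  have "(2::real) ^ n0 \<le> 2 ^ 2 ^ n"
    using less_exp[of n] by (intro power_increasing) (auto simp: n_def)
  then have fn: "\<bar>f y\<bar> \<le> 2 ^ 2 ^ n" for y
    using fb[of y] n0 by linarith
  define F where "F k y = piece k (f y)" for k y
  have [measurable]: "f \<in> borel_measurable M"
    by (rule bounded_cs_measurable[OF f])
  have Fm [measurable]: "F k \<in> borel_measurable M" for k
    unfolding F_def by measurable
  have Fb: "bounded_cs (F k)" for k
    by (rule bounded_cs_mono[OF f Fm]) (simp add: F_def abs_piece_le)
  have fF: "f = (\<lambda>y. \<Sum>k<n. F k y)"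
    unfolding F_def using sum_piece[OF n fn] by simp
  define S where "S k i = {x. ereal ((1/2) ^ Suc i) < maxop \<kappa> (F k) x}" for k i
  have S [measurable]: "S k i \<in> sets M" for k i
    unfolding S_def by (intro level_set_measurable Fb \<kappa>)
  \<comment> \<open>A majorant independent of the index \<open>j\<close> of the kernel, so that a
    single use of Markov's inequality handles the supremum over \<open>j\<close>.\<close>
  define H where "H x = (\<Sum>k<n. \<Sum>i<levels k. ennreal ((1/2) ^ i) * indicator (S k i) x)" for x
  have Hm [measurable]: "H \<in> borel_measurable M"
    unfolding H_def by measurable
  have sub: "{x. ereal 1 < maxop \<kappa> f x} \<subseteq> {x\<in>space M. 1 \<le> 2 * H x}"
  proof
    fix x assume "x \<in> {x. ereal 1 < maxop \<kappa> f x}"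
    then obtain j where j: "1 < \<bar>conv f (\<kappa> j) x\<bar>"
      by (auto simp: less_maxop_iff)
    define a where "a k = \<bar>conv (F k) (\<kappa> j) x\<bar>" for k
    have "conv f (\<kappa> j) x = (\<Sum>k<n. conv (F k) (\<kappa> j) x)"
      by (subst fF) (rule conv_sum[OF Fb \<kappa>])
    then have "1 < (\<Sum>k<n. a k)"
      using j sum_abs[of "\<lambda>k. conv (F k) (\<kappa> j) x" "{..<n}"] unfolding a_def by linarith
    then have "1/2 \<le> (\<Sum>k<n. dyadic_part (levels k) (a k))"
      by (intro sum_dyadic_part) (simp add: a_def)
    then have "ennreal (1/2) \<le> ennreal (\<Sum>k<n. dyadic_part (levels k) (a k))"
      by (rule ennreal_leI)
    also have "\<dots> = (\<Sum>k<n. ennreal (dyadic_part (levels k) (a k)))"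
      using dyadic_part_nonneg by (simp add: sum_ennreal)
    also have "\<dots> \<le> H x"
      unfolding H_def
    proof (rule sum_mono)
      fix k
      have "ennreal (dyadic_part (levels k) (a k))
          = (\<Sum>i<levels k. ennreal ((1/2) ^ i * (if (1/2) ^ Suc i < a k then 1 else 0)))"
        unfolding dyadic_part_def by (intro sum_ennreal[symmetric]) auto
      also have "\<dots> \<le> (\<Sum>i<levels k. ennreal ((1/2) ^ i) * indicator (S k i) x)"
      proof (rule sum_mono)
        fix i
        show "ennreal ((1/2) ^ i * (if (1/2) ^ Suc i < a k then 1 else 0)) \<le> ennreal ((1/2) ^ i) * indicator (S k i) x"
        proof (cases "(1/2) ^ Suc i < a k")
          case True
          then have "x \<in> S k i"
            unfolding S_def a_def less_maxop_iff by blast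
          with True show ?thesis by simp
        qed simp
      qed
      finally show "ennreal (dyadic_part (levels k) (a k))
          \<le> (\<Sum>i<levels k. ennreal ((1/2) ^ i) * indicator (S k i) x)" .
    qed
    finally have "2 * ennreal (1/2) \<le> 2 * H x"
      by (rule mult_left_mono) simp
    moreover have "2 * ennreal (1/2) = 1"
      using ennreal_mult[of 2 "1/2"] by simp
    ultimately show "x \<in> {x\<in>space M. 1 \<le> 2 * H x}"
      by simp
  qed
  have FI: "(\<integral>\<^sup>+y. ennreal \<bar>F k y\<bar> \<partial>M) = ennreal (\<integral>y. \<bar>F k y\<bar> \<partial>M)" for k
    using bounded_cs_integrable[OF Fb] by (intro nn_integral_eq_integral) auto
  have I: "(\<integral>\<^sup>+x. H x \<partial>M) \<le> (\<Sum>k<n. ennreal (2 * D) * (ennreal (levels k * 2 powr (m * k)) * (\<integral>\<^sup>+y. ennreal \<bar>F k y\<bar> \<partial>M)))"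
  proof -
    have "(\<integral>\<^sup>+x. H x \<partial>M) = (\<Sum>k<n. \<integral>\<^sup>+x. (\<Sum>i<levels k. ennreal ((1/2) ^ i) * indicator (S k i) x) \<partial>M)"
      unfolding H_def by (rule nn_integral_sum) measurable
    also have "\<dots> = (\<Sum>k<n. \<Sum>i<levels k. \<integral>\<^sup>+x. ennreal ((1/2) ^ i) * indicator (S k i) x \<partial>M)"
      by (intro sum.cong refl nn_integral_sum) measurable
    also have "\<dots> = (\<Sum>k<n. \<Sum>i<levels k. ennreal ((1/2) ^ i) * emeasure M (S k i))"
      by (simp only: nn_integral_cmult_indicator[OF S])
    also have "\<dots> \<le> (\<Sum>k<n. ennreal (2 * D) * (ennreal (levels k * 2 powr (m * k)) * (\<integral>\<^sup>+y. ennreal \<bar>F k y\<bar> \<partial>M)))"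
    proof (rule sum_mono)
      fix k
      define J where "J = (\<integral>y. \<bar>F k y\<bar> \<partial>M)"
      have J: "0 \<le> J" by (simp add: J_def)
      \<comment> \<open>The weight cancels \<open>2 ^ Suc i\<close> up to a factor 2. All levels
        thus receive the same bound, and their number \<open>levels k\<close> appears.\<close>
      have "(\<Sum>i<levels k. ennreal ((1/2) ^ i) * emeasure M (S k i)) \<le> (\<Sum>i<levels k. ennreal (2 * D * 2 powr (m * k) * J))"
      proof (rule sum_mono)
        fix i assume "i \<in> {..<levels k}"
        then have "emeasure M (S k i) \<le> ennreal (D * 2 powr (m * k) * 2 ^ Suc i * J)"
          unfolding S_def J_def using abs_piece_le(2) by (intro piece_bound Fb) (auto simp: F_def)
        then have "ennreal ((1/2) ^ i) * emeasure M (S k i) \<le> ennreal ((1/2) ^ i) * ennreal (D * 2 powr (m * k) * 2 ^ Suc i * J)"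
          by (rule mult_left_mono) simp
        also have "\<dots> = ennreal ((1/2) ^ i * (D * 2 powr (m * k) * 2 ^ Suc i * J))"
          by (rule ennreal_mult'[symmetric]) simp
        also have "(1/2) ^ i * (D * 2 powr (m * k) * 2 ^ Suc i * J) = 2 * D * 2 powr (m * k) * J"
          by (simp add: power_one_over)
        finally show "ennreal ((1/2) ^ i) * emeasure M (S k i) \<le> ennreal (2 * D * 2 powr (m * k) * J)" .
      qed
      also have "\<dots> = ennreal (real (levels k) * (2 * D * 2 powr (m * k) * J))"
        using D J by (subst sum_ennreal) auto
      also have "real (levels k) * (2 * D * 2 powr (m * k) * J) = 2 * D * ((levels k * 2 powr (m * k)) * J)"
        by simp
      also have "ennreal \<dots> = ennreal (2 * D) * (ennreal (levels k * 2 powr (m * k)) * ennreal J)"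
        using D J by (simp add: ennreal_mult)
      finally show "(\<Sum>i<levels k. ennreal ((1/2) ^ i) * emeasure M (S k i))
          \<le> ennreal (2 * D) * (ennreal (levels k * 2 powr (m * k)) * (\<integral>\<^sup>+y. ennreal \<bar>F k y\<bar> \<partial>M))"
        unfolding FI J_def .
    qed
    finally show ?thesis .
  qed
  have "emeasure M {x. ereal 1 < maxop \<kappa> f x} \<le> emeasure M {x\<in>space M. 1 \<le> 2 * H x}"
    by (rule emeasure_mono[OF sub]) measurable
  also have "\<dots> \<le> 2 * (\<integral>\<^sup>+x. H x * indicator (space M) x \<partial>M)"
    by (rule nn_integral_Markov_inequality) auto
  also have "(\<integral>\<^sup>+x. H x * indicator (space M) x \<partial>M) = (\<integral>\<^sup>+x. H x \<partial>M)"
    by simp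
  also have "2 * \<dots> \<le> 2 * (\<Sum>k<n. ennreal (2 * D) * (ennreal (levels k * 2 powr (m * k)) * (\<integral>\<^sup>+y. ennreal \<bar>F k y\<bar> \<partial>M)))"
    by (rule mult_left_mono[OF I]) simp
  also have "\<dots> = 2 * (ennreal (2 * D) * (\<integral>\<^sup>+y. (\<Sum>k<n. ennreal (levels k * 2 powr (m * k)) * ennreal \<bar>F k y\<bar>) \<partial>M))"
    by (simp add: nn_integral_sum nn_integral_cmult sum_distrib_left)
  also have "\<dots> \<le> 2 * (ennreal (2 * D) * (\<integral>\<^sup>+y. ennreal 6 * ennreal (antonov_phi m \<bar>f y\<bar>) \<partial>M))"
  proof (intro mult_left_mono nn_integral_mono)
    fix y
    have "(\<Sum>k<n. ennreal (levels k * 2 powr (m * k)) * ennreal \<bar>F k y\<bar>)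
        = ennreal (\<Sum>k<n. levels k * 2 powr (m * k) * \<bar>F k y\<bar>)"
      by (simp add: ennreal_mult[symmetric] sum_ennreal)
    also have "\<dots> \<le> ennreal (6 * antonov_phi m \<bar>f y\<bar>)"
      unfolding F_def by (intro ennreal_leI sum_weighted_piece_le m n fn)
    also have "\<dots> = ennreal 6 * ennreal (antonov_phi m \<bar>f y\<bar>)"
      by (rule ennreal_mult') simp
    finally show "(\<Sum>k<n. ennreal (levels k * 2 powr (m * k)) * ennreal \<bar>F k y\<bar>) \<le> ennreal 6 * ennreal (antonov_phi m \<bar>f y\<bar>)" .
  qed auto
  also have "\<dots> = 2 * (ennreal (2 * D) * (ennreal 6 * (\<integral>\<^sup>+y. ennreal (antonov_phi m \<bar>f y\<bar>) \<partial>M)))"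
    by (subst nn_integral_cmult) (auto simp: antonov_phi_def logp_eq)
  also have "\<dots> = ennreal 2 * ennreal (2 * D) * ennreal 6 * (\<integral>\<^sup>+y. ennreal (antonov_phi m \<bar>f y\<bar>) \<partial>M)"
    by (simp add: mult.assoc)
  also have "ennreal 2 * ennreal (2 * D) * ennreal 6 = ennreal (24 * D)"
    using D by (simp add: ennreal_mult[symmetric] del: ennreal_numeral)
  finally show ?thesis .
qed

text \<open>The strict inequality at a point passes from \<open>f\<close> to its truncations from
  some index on, so Fatou's lemma applies to the indicators of the level sets; the exceptional null
  sets of the countably many kernels are united. Measurability of the level set of \<open>f\<close>
  is a hypothesis here, which \<open>sublinear_operator\<close> will supply.\<close>

lemma phi_type_integrable:
  assumes \<kappa>: "\<And>j. integrable M (\<kappa> j)" and m: "0 < m"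
    and bounded: "\<And>f. bounded_cs f \<Longrightarrow>
      emeasure M {x. ereal 1 < maxop \<kappa> f x} \<le> ennreal D * (\<integral>\<^sup>+y. ennreal (antonov_phi m \<bar>f y\<bar>) \<partial>M)"
    and f: "integrable M f" and meas: "{x. ereal 1 < maxop \<kappa> f x} \<in> sets M"
  shows "emeasure M {x. ereal 1 < maxop \<kappa> f x} \<le> ennreal D * (\<integral>\<^sup>+y. ennreal (antonov_phi m \<bar>f y\<bar>) \<partial>M)"
proof -
  obtain K :: "nat \<Rightarrow> 'a set" where K: "\<And>n. compact (K n)" "incseq K" "(\<Union>n. K n) = UNIV"
    using exhaustion by metis
  define fn where "fn n y = indicator (K n \<inter> {y. \<bar>f y\<bar> \<le> real n}) y * f y" for n y
  have [measurable]: "f \<in> borel_measurable M"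
    using f by auto
  have [measurable]: "K n \<in> sets M" for n
    using K(1) by (rule compact_sets)
  have fm [measurable]: "fn n \<in> borel_measurable M" for n
    unfolding fn_def by measurable
  have fb: "bounded_cs (fn n)" for n
    unfolding bounded_cs_def
    by (intro conjI exI[of _ "K n"] exI[of _ "real n"] K fm) (auto simp: fn_def indicator_def)
  have sm: "{x. ereal 1 < maxop \<kappa> (fn n) x} \<in> sets M" for n
    by (rule level_set_measurable[OF fb \<kappa>])
  have "\<forall>j. AE x in M. (\<lambda>n. conv (fn n) (\<kappa> j) x) \<longlonglongrightarrow> conv f (\<kappa> j) x"
    unfolding fn_def by (intro allI conv_truncate_tendsto f \<kappa> K)
  then have "AE x in M. \<forall>j. (\<lambda>n. conv (fn n) (\<kappa> j) x) \<longlonglongrightarrow> conv f (\<kappa> j) x"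
    by (simp add: AE_all_countable)
  then have ae: "AE x in M. (indicator {x. ereal 1 < maxop \<kappa> f x} x :: ennreal)
      \<le> liminf (\<lambda>n. indicator {x. ereal 1 < maxop \<kappa> (fn n) x} x)"
  proof (rule AE_mp, intro AE_I2 impI)
    fix x assume lim: "\<forall>j. (\<lambda>n. conv (fn n) (\<kappa> j) x) \<longlonglongrightarrow> conv f (\<kappa> j) x"
    show "(indicator {x. ereal 1 < maxop \<kappa> f x} x :: ennreal)
        \<le> liminf (\<lambda>n. indicator {x. ereal 1 < maxop \<kappa> (fn n) x} x)"
    proof (cases "ereal 1 < maxop \<kappa> f x")
      case True
      then obtain j where j: "1 < \<bar>conv f (\<kappa> j) x\<bar>"
        by (auto simp: less_maxop_iff)
      have "(\<lambda>n. \<bar>conv (fn n) (\<kappa> j) x\<bar>) \<longlonglongrightarrow> \<bar>conv f (\<kappa> j) x\<bar>"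
        using lim by (intro tendsto_rabs) simp
      then have "eventually (\<lambda>n. 1 < \<bar>conv (fn n) (\<kappa> j) x\<bar>) sequentially"
        using j by (rule order_tendstoD)
      then have "eventually (\<lambda>n. (1::ennreal) \<le> indicator {x. ereal 1 < maxop \<kappa> (fn n) x} x) sequentially"
        by (rule eventually_mono) (force simp: less_maxop_iff indicator_def)
      then have "(1::ennreal) \<le> liminf (\<lambda>n. indicator {x. ereal 1 < maxop \<kappa> (fn n) x} x)"
        by (rule Liminf_bounded)
      with True show ?thesis by simp
    qed simp
  qed
  have "emeasure M {x. ereal 1 < maxop \<kappa> f x} = (\<integral>\<^sup>+x. indicator {x. ereal 1 < maxop \<kappa> f x} x \<partial>M)"
    using meas by (rule nn_integral_indicator[symmetric])
  also have "\<dots> \<le> (\<integral>\<^sup>+x. liminf (\<lambda>n. indicator {x. ereal 1 < maxop \<kappa> (fn n) x} x) \<partial>M)"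
    by (rule nn_integral_mono_AE[OF ae])
  also have "\<dots> \<le> liminf (\<lambda>n. \<integral>\<^sup>+x. indicator {x. ereal 1 < maxop \<kappa> (fn n) x} x \<partial>M)"
    by (rule nn_integral_liminf) (use sm in simp)
  also have "\<dots> = liminf (\<lambda>n. emeasure M {x. ereal 1 < maxop \<kappa> (fn n) x})"
    by (simp only: nn_integral_indicator[OF sm])
  also have "\<dots> \<le> liminf (\<lambda>n::nat. ennreal D * (\<integral>\<^sup>+y. ennreal (antonov_phi m \<bar>f y\<bar>) \<partial>M))"
  proof (intro Liminf_mono always_eventually allI)
    fix n
    have "antonov_phi m \<bar>fn n y\<bar> \<le> antonov_phi m \<bar>f y\<bar>" for y
    proof (rule mono_onD[of "{0..}" "antonov_phi m"])
      show "mono_on {0..} (antonov_phi m)"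
        using antonov_phi_in_Phi[OF m] by (simp add: Phi_def)
    qed (auto simp: fn_def indicator_def)
    then show "emeasure M {x. ereal 1 < maxop \<kappa> (fn n) x} \<le> ennreal D * (\<integral>\<^sup>+y. ennreal (antonov_phi m \<bar>f y\<bar>) \<partial>M)"
      by (intro order_trans[OF bounded[OF fb]] mult_left_mono nn_integral_mono ennreal_leI) auto
  qed
  finally show ?thesis
    by (simp add: Liminf_const)
qed

section \<open>The inclusion of the classes of operators\<close>

lemma L1_real_integrable:
  assumes "f \<in> L1 M"
  shows "integrable M (\<lambda>x. real_of_ereal (f x))"
proof (rule integrableI_bounded)
  show "(\<lambda>x. real_of_ereal (f x)) \<in> borel_measurable M"
    using assms by (auto simp: L1_def)
  have "(\<integral>\<^sup>+x. ennreal (norm (real_of_ereal (f x))) \<partial>M) \<le> (\<integral>\<^sup>+x. e2ennreal \<bar>f x\<bar> \<partial>M)"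
  proof (rule nn_integral_mono)
    fix x
    show "ennreal (norm (real_of_ereal (f x))) \<le> e2ennreal \<bar>f x\<bar>"
      by (cases "f x") auto
  qed
  also have "\<dots> < \<infinity>"
    using assms by (simp add: L1_def)
  finally show "(\<integral>\<^sup>+x. ennreal (norm (real_of_ereal (f x))) \<partial>M) < \<infinity>" .
qed

text \<open>\<open>real_of_ereal\<close> is multiplicative, infinite values included, so the
  equality holds at every point and not just almost everywhere.\<close>

lemma maximal_operator_eq:
  "maximal_operator M k f = maxop (\<lambda>j x. real_of_ereal (k j x)) (\<lambda>x. real_of_ereal (f x))"
  by (simp add: fun_eq_iff maximal_operator_def maxop_def convolution_def conv_def)

lemma maxop_divide:
  assumes "0 < t"
  shows "ereal 1 < maxop \<kappa> (\<lambda>y. f y / t) x \<longleftrightarrow> ereal t < maxop \<kappa> f x"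
  using assms by (auto simp: less_maxop_iff conv_divide abs_divide)

lemma maxop_nonneg: "0 \<le> maxop \<kappa> f x"
  unfolding maxop_def by (rule SUP_upper2[of 0]) auto

lemma maximal_inclusion:
  assumes m: "0 < m"
  shows "maximal_operators M \<inter> H_class m M \<subseteq> A_class m M"
proof
  fix T assume T: "T \<in> maximal_operators M \<inter> H_class m M"
  then obtain k where k: "T = maximal_operator M k" "\<And>j. k j \<in> L1 M"
    unfolding maximal_operators_def by auto
  define \<kappa> where "\<kappa> j x = real_of_ereal (k j x)" for j x
  have \<kappa>: "integrable M (\<kappa> j)" for j
    unfolding \<kappa>_def by (rule L1_real_integrable[OF k(2)])
  have Tf: "T f = maxop \<kappa> (\<lambda>x. real_of_ereal (f x))" for f
    unfolding k(1) maximal_operator_eq \<kappa>_def ..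
  have Tabs: "\<bar>T f x\<bar> = maxop \<kappa> (\<lambda>x. real_of_ereal (f x)) x" for f x
    unfolding Tf by (rule abs_ereal_ge0[OF maxop_nonneg])
  have ind: "(\<lambda>x. real_of_ereal (indicator E x)) = indicator E" for E :: "'a set"
    by (auto simp: fun_eq_iff indicator_def)
  have sl: "sublinear_operator M T"
    using T by (simp add: H_class_def)
  obtain r C where r: "1 < r" "0 < C" and rC: "\<And>p. 1 < p \<Longrightarrow> p < r \<Longrightarrow>
      \<exists>Cp. Cp \<le> (C / (p - 1)) powr (m * p) \<and> restricted_weak_type M T p Cp"
    using T unfolding H_class_def by auto
  have rw: "\<exists>Cp \<le> (C / (p - 1)) powr (m * p). \<forall>E\<in>sets M. emeasure M E < \<infinity> \<longrightarrow>
      (\<forall>t>0. emeasure M {x. ereal t < maxop \<kappa> (indicator E) x} \<le> ennreal (Cp * t powr (- p)) * emeasure M E)"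
    if p: "1 < p" "p < r" for p
  proof -
    obtain Cp where Cp: "Cp \<le> (C / (p - 1)) powr (m * p)" "restricted_weak_type M T p Cp"
      using rC[OF p] by blast
    show ?thesis
      using Cp(2) unfolding restricted_weak_type_def Tabs ind
      by (intro exI[of _ Cp] conjI Cp(1)) simp
  qed
  obtain D0 where D0: "0 < D0 \<and> (\<forall>k i f. i < levels k \<longrightarrow> bounded_cs f \<longrightarrow> (\<forall>y. \<bar>f y\<bar> \<le> 2 ^ 2 ^ Suc k) \<longrightarrow>
    emeasure M {x. ereal ((1/2) ^ Suc i) < maxop \<kappa> f x}
      \<le> ennreal (D0 * 2 powr (m * k) * 2 ^ Suc i * (\<integral>y. \<bar>f y\<bar> \<partial>M)))"
    using weak_type_piece[OF \<kappa> rw r m] by (rule exE)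
  note bounded = phi_type_bounded[OF \<kappa> m D0[THEN conjunct1] D0[THEN conjunct2, rule_format]]
  have est: "emeasure M ({x \<in> space M. ereal t < \<bar>T f x\<bar>} \<inter> Y) \<le> ennreal \<epsilon> + ennreal (24 * D0) *
      (\<integral>\<^sup>+x. ennreal (antonov_phi m (real_of_ereal \<bar>f x\<bar> / t)) \<partial>M)"
    if f: "f \<in> L1 M" and t: "0 < t" for f t \<epsilon> Y
  proof -
    define g where "g x = real_of_ereal (f x) / t" for x
    have g: "integrable M g"
      unfolding g_def using L1_real_integrable[OF f] by simp
    have "T f \<in> borel_measurable M"
      using sl f by (simp add: sublinear_operator_def)
    then have "{x \<in> space M. ereal t < T f x} \<in> sets M"
      by measurable
    moreover have eq: "{x. ereal 1 < maxop \<kappa> g x} = {x. ereal t < T f x}"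
      unfolding g_def Tf by (simp only: maxop_divide[OF t])
    ultimately have gm: "{x. ereal 1 < maxop \<kappa> g x} \<in> sets M"
      by simp
    have abs: "\<bar>g x\<bar> = real_of_ereal \<bar>f x\<bar> / t" for x
      unfolding g_def using t by (cases "f x") auto
    have "{x \<in> space M. ereal t < \<bar>T f x\<bar>} \<inter> Y \<subseteq> {x. ereal 1 < maxop \<kappa> g x}"
      unfolding eq by (auto simp: Tf abs_ereal_ge0[OF maxop_nonneg])
    then have "emeasure M ({x \<in> space M. ereal t < \<bar>T f x\<bar>} \<inter> Y) \<le> emeasure M {x. ereal 1 < maxop \<kappa> g x}"
      using gm by (rule emeasure_mono)
    also have "\<dots> \<le> ennreal (24 * D0) * (\<integral>\<^sup>+x. ennreal (antonov_phi m \<bar>g x\<bar>) \<partial>M)"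
      by (rule phi_type_integrable[OF \<kappa> m bounded g gm])
    finally show ?thesis
      unfolding abs by (rule order_trans) simp
  qed
  have "generalized_weak_type M T (antonov_phi m)"
    unfolding generalized_weak_type_def
  proof (intro conjI ballI impI allI exI[of _ "24 * D0"])
    show "antonov_phi m \<in> Phi" by (rule antonov_phi_in_Phi[OF m])
    show "0 < 24 * D0" using D0 by simp
  qed (rule est)
  then show "T \<in> A_class m M"
    using sl by (simp add: A_class_def antonov_phi_def[abs_def])
qed

end

theorem theorem1:
  fixes M :: "'a::{topological_group_add, t2_space} measure" and m :: real
  assumes "locally_compact_space (euclidean :: 'a topology)"
    and "sigma_compact (UNIV :: 'a set)"
    and "(euclidean :: 'a topology) \<noteq> discrete_topology UNIV"
    and "left_haar_measure M"
    and "0 < m"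
  shows "maximal_operators M \<inter> H_class m M \<subseteq> A_class m M"
proof -
  interpret haar_group M
    by unfold_locales (fact assms)+
  show ?thesis
    by (rule maximal_inclusion[OF assms(5)])
qed

end
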